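(* Let $X$ be an affine algebraic variety and $Y\subseteq X$ a closed subvariety containing $X_{\mathrm{sing}}$ such that $X$ is homogeneous with respect to $Y$. Let $L$ be a finitely generated $\mathbb{C}[X]$-submodule of $\mathrm{VF}_{\mathrm{alg}}(X,Y)$ with $L\subseteq \mathrm{Lie}_{\mathrm{alg}}(X,Y)$. If for some $x_0\in X\setminus Y$ the fiber $\{\partial[x_0]:\partial\in L\}\subseteq T_{x_0}X$ contains a generating set, then $X$ has the algebraic density property relative to $Y$.
   Context: $I=I(Y)\subseteq\mathbb{C}[X]$ is the ideal of $Y$; $\mathrm{VF}_{\mathrm{alg}}(X,Y)$ is the $\mathbb{C}[X]$-module of derivations $\partial$ of $\mathbb{C}[X]$ with $\partial(\mathbb{C}[X])\subseteq I$; $\mathrm{Lie}_{\mathrm{alg}}(X,Y)$ is the Lie algebra generated by all complete vector fields (holomorphic flow defined for all complex times and initial points) in $\mathrm{VF}_{\mathrm{alg}}(X,Y)$. $X$ has the ADP relative to $Y$ if there exists $\ell\ge0$ with $I^\ell\,\mathrm{VF}_{\mathrm{alg}}(X,Y)\subseteq\mathrm{Lie}_{\mathrm{alg}}(X,Y)$. Let $\mathrm{Aut}(X,Y)$ be the group of algebraic automorphisms of $X$ stabilizing $Y$; $X$ is homogeneous with respect to $Y$ if $\mathrm{Aut}(X,Y)$ acts transitively on $X\setminus Y$. For a smooth point $x_0$, a finite subset $S\subseteq T_{x_0}X$ is a generating set if the images of $S$ under (the differentials of) the elements of the isotropy group of $x_0$ in $\mathrm{Aut}(X,Y)$ span $T_{x_0}X$.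 *)

theory Defs
  imports "HOL-Analysis.Analysis"
begin

(* Affine space C^n is modelled as complex^'n for an arbitrary finite index type 'n.
   Regular functions are functions (complex^'n => complex) that are zero outside X. *)

type_synonym 'n rfun = "complex^'n \<Rightarrow> complex"

inductive_set poly_fun :: "'n::finite rfun set" where
  pconst: "(\<lambda>x. c) \<in> poly_fun"
| pcoord: "(\<lambda>x. x $ i) \<in> poly_fun"
| padd: "p \<in> poly_fun \<Longrightarrow> q \<in> poly_fun \<Longrightarrow> (\<lambda>x. p x + q x) \<in> poly_fun"
| pmult: "p \<in> poly_fun \<Longrightarrow> q \<in> poly_fun \<Longrightarrow> (\<lambda>x. p x * q x) \<in> poly_fun"

definition algebraic_set :: "(complex^'n::finite) set \<Rightarrow> bool" where
  "algebraic_set A \<longleftrightarrow> (\<exists>S. S \<subseteq> poly_fun \<and> A = {x. \<forall>p\<in>S. p x = 0})"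

definition affine_variety :: "(complex^'n::finite) set \<Rightarrow> bool" where
  "affine_variety X \<longleftrightarrow> algebraic_set X \<and> X \<noteq> {} \<and>
     (\<forall>A B. algebraic_set A \<longrightarrow> algebraic_set B \<longrightarrow> X = A \<union> B \<longrightarrow> X = A \<or> X = B)"

definition coord_ring :: "(complex^'n::finite) set \<Rightarrow> 'n rfun set" where
  "coord_ring X = {f. \<exists>p\<in>poly_fun. \<forall>x. f x = (if x \<in> X then p x else 0)}"

definition vanishing_ideal :: "(complex^'n::finite) set \<Rightarrow> (complex^'n) set \<Rightarrow> 'n rfun set" where
  "vanishing_ideal X Y = {f \<in> coord_ring X. \<forall>y\<in>Y. f y = 0}"

definition is_derivation :: "(complex^'n::finite) set \<Rightarrow> ('n rfun \<Rightarrow> 'n rfun) \<Rightarrow> bool" where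
  "is_derivation X D \<longleftrightarrow>
     (\<forall>f\<in>coord_ring X. D f \<in> coord_ring X) \<and>
     (\<forall>f. f \<notin> coord_ring X \<longrightarrow> D f = (\<lambda>x. 0)) \<and>
     (\<forall>f\<in>coord_ring X. \<forall>g\<in>coord_ring X. D (\<lambda>x. f x + g x) = (\<lambda>x. D f x + D g x)) \<and>
     (\<forall>c. \<forall>f\<in>coord_ring X. D (\<lambda>x. c * f x) = (\<lambda>x. c * D f x)) \<and>
     (\<forall>f\<in>coord_ring X. \<forall>g\<in>coord_ring X. D (\<lambda>x. f x * g x) = (\<lambda>x. f x * D g x + g x * D f x))"

definition VF_alg :: "(complex^'n::finite) set \<Rightarrow> (complex^'n) set \<Rightarrow> ('n rfun \<Rightarrow> 'n rfun) set" where
  "VF_alg X Y = {D. is_derivation X D \<and> (\<forall>f\<in>coord_ring X. D f \<in> vanishing_ideal X Y)}"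

definition coord_fun :: "(complex^'n::finite) set \<Rightarrow> 'n \<Rightarrow> 'n rfun" where
  "coord_fun X i = (\<lambda>x. if x \<in> X then x $ i else 0)"

definition complete_field :: "(complex^'n::finite) set \<Rightarrow> ('n rfun \<Rightarrow> 'n rfun) \<Rightarrow> bool" where
  "complete_field X D \<longleftrightarrow> (\<forall>x\<in>X. \<exists>\<gamma> :: complex \<Rightarrow> complex^'n.
      \<gamma> 0 = x \<and> (\<forall>t. \<gamma> t \<in> X) \<and>
      (\<forall>t i. ((\<lambda>s. \<gamma> s $ i) has_field_derivative D (coord_fun X i) (\<gamma> t)) (at t)))"

definition mod_smult :: "'n rfun \<Rightarrow> ('n rfun \<Rightarrow> 'n rfun) \<Rightarrow> ('n rfun \<Rightarrow> 'n rfun)" where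
  "mod_smult g D = (\<lambda>f x. g x * D f x)"

definition vf_add :: "('n rfun \<Rightarrow> 'n rfun) \<Rightarrow> ('n rfun \<Rightarrow> 'n rfun) \<Rightarrow> ('n rfun \<Rightarrow> 'n rfun)" where
  "vf_add D E = (\<lambda>f x. D f x + E f x)"

definition vf_bracket :: "('n rfun \<Rightarrow> 'n rfun) \<Rightarrow> ('n rfun \<Rightarrow> 'n rfun) \<Rightarrow> ('n rfun \<Rightarrow> 'n rfun)" where
  "vf_bracket D E = (\<lambda>f x. D (E f) x - E (D f) x)"

inductive_set Lie_alg :: "(complex^'n::finite) set \<Rightarrow> (complex^'n) set \<Rightarrow> ('n rfun \<Rightarrow> 'n rfun) set"
  for X Y where
  lgen: "D \<in> VF_alg X Y \<Longrightarrow> complete_field X D \<Longrightarrow> D \<in> Lie_alg X Y"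
| lzero: "(\<lambda>f x. 0) \<in> Lie_alg X Y"
| ladd: "D \<in> Lie_alg X Y \<Longrightarrow> E \<in> Lie_alg X Y \<Longrightarrow> vf_add D E \<in> Lie_alg X Y"
| lscale: "D \<in> Lie_alg X Y \<Longrightarrow> (\<lambda>f x. (c::complex) * D f x) \<in> Lie_alg X Y"
| lbracket: "D \<in> Lie_alg X Y \<Longrightarrow> E \<in> Lie_alg X Y \<Longrightarrow> vf_bracket D E \<in> Lie_alg X Y"

inductive_set ideal_pow :: "(complex^'n::finite) set \<Rightarrow> (complex^'n) set \<Rightarrow> nat \<Rightarrow> 'n rfun set"
  for X Y l where
  ipgen: "r \<in> coord_ring X \<Longrightarrow> length fs = l \<Longrightarrow> set fs \<subseteq> vanishing_ideal X Y \<Longrightarrow>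
          (\<lambda>x. r x * prod_list (map (\<lambda>f. f x) fs)) \<in> ideal_pow X Y l"
| ipadd: "f \<in> ideal_pow X Y l \<Longrightarrow> g \<in> ideal_pow X Y l \<Longrightarrow> (\<lambda>x. f x + g x) \<in> ideal_pow X Y l"

inductive_set module_prod :: "'n rfun set \<Rightarrow> ('n rfun \<Rightarrow> 'n rfun) set \<Rightarrow> ('n rfun \<Rightarrow> 'n rfun) set"
  for A M where
  mpgen: "g \<in> A \<Longrightarrow> D \<in> M \<Longrightarrow> mod_smult g D \<in> module_prod A M"
| mpadd: "D \<in> module_prod A M \<Longrightarrow> E \<in> module_prod A M \<Longrightarrow> vf_add D E \<in> module_prod A M"

definition ADP_rel :: "(complex^'n::finite) set \<Rightarrow> (complex^'n) set \<Rightarrow> bool" where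
  "ADP_rel X Y \<longleftrightarrow> (\<exists>l. module_prod (ideal_pow X Y l) (VF_alg X Y) \<subseteq> Lie_alg X Y)"

definition poly_map :: "(complex^'n::finite) set \<Rightarrow> (complex^'n \<Rightarrow> complex^'n) \<Rightarrow> bool" where
  "poly_map X \<phi> \<longleftrightarrow> \<phi> ` X \<subseteq> X \<and> (\<forall>i. \<exists>p\<in>poly_fun. \<forall>x\<in>X. \<phi> x $ i = p x)"

definition Aut_rel :: "(complex^'n::finite) set \<Rightarrow> (complex^'n) set \<Rightarrow> (complex^'n \<Rightarrow> complex^'n) set" where
  "Aut_rel X Y = {\<phi>. poly_map X \<phi> \<and> \<phi> ` Y = Y \<and>
      (\<exists>\<psi>. poly_map X \<psi> \<and> (\<forall>x\<in>X. \<psi> (\<phi> x) = x \<and> \<phi> (\<psi> x) = x))}"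

definition homogeneous_rel :: "(complex^'n::finite) set \<Rightarrow> (complex^'n) set \<Rightarrow> bool" where
  "homogeneous_rel X Y \<longleftrightarrow> (\<forall>x\<in>X - Y. \<forall>y\<in>X - Y. \<exists>\<phi>\<in>Aut_rel X Y. \<phi> x = y)"

definition tangent_space :: "(complex^'n::finite) set \<Rightarrow> complex^'n \<Rightarrow> ('n rfun \<Rightarrow> complex) set" where
  "tangent_space X x = {v.
     (\<forall>f. f \<notin> coord_ring X \<longrightarrow> v f = 0) \<and>
     (\<forall>f\<in>coord_ring X. \<forall>g\<in>coord_ring X. v (\<lambda>y. f y + g y) = v f + v g) \<and>
     (\<forall>c. \<forall>f\<in>coord_ring X. v (\<lambda>y. c * f y) = c * v f) \<and>
     (\<forall>f\<in>coord_ring X. \<forall>g\<in>coord_ring X. v (\<lambda>y. f y * g y) = f x * v g + g x * v f)}"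

definition cspan :: "('a \<Rightarrow> complex) set \<Rightarrow> ('a \<Rightarrow> complex) set" where
  "cspan V = {(\<lambda>f. \<Sum>v\<in>F. c v * v f) | F c. finite F \<and> F \<subseteq> V}"

definition tdim :: "(complex^'n::finite) set \<Rightarrow> complex^'n \<Rightarrow> nat" where
  "tdim X x = (LEAST k. \<exists>F. finite F \<and> card F = k \<and> F \<subseteq> tangent_space X x \<and>
                              tangent_space X x \<subseteq> cspan F)"

(* For an irreducible variety: smooth points are those where the tangent dimension is minimal *)
definition smooth_point :: "(complex^'n::finite) set \<Rightarrow> complex^'n \<Rightarrow> bool" where
  "smooth_point X x \<longleftrightarrow> x \<in> X \<and> (\<forall>y\<in>X. tdim X x \<le> tdim X y)"

definition sing_locus :: "(complex^'n::finite) set \<Rightarrow> (complex^'n) set" where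
  "sing_locus X = {x \<in> X. \<not> smooth_point X x}"

definition pullback :: "(complex^'n::finite) set \<Rightarrow> (complex^'n \<Rightarrow> complex^'n) \<Rightarrow> 'n rfun \<Rightarrow> 'n rfun" where
  "pullback X \<phi> f = (\<lambda>x. if x \<in> X then f (\<phi> x) else 0)"

definition differential :: "(complex^'n::finite) set \<Rightarrow> (complex^'n \<Rightarrow> complex^'n) \<Rightarrow> ('n rfun \<Rightarrow> complex) \<Rightarrow> ('n rfun \<Rightarrow> complex)" where
  "differential X \<phi> v = (\<lambda>f. if f \<in> coord_ring X then v (pullback X \<phi> f) else 0)"

definition generating_set :: "(complex^'n::finite) set \<Rightarrow> (complex^'n) set \<Rightarrow> complex^'n \<Rightarrow> ('n rfun \<Rightarrow> complex) set \<Rightarrow> bool" where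
  "generating_set X Y x0 S \<longleftrightarrow> finite S \<and> S \<subseteq> tangent_space X x0 \<and>
     cspan {differential X \<phi> v | \<phi> v. \<phi> \<in> Aut_rel X Y \<and> \<phi> x0 = x0 \<and> v \<in> S} = tangent_space X x0"

definition fiber :: "(complex^'n::finite) set \<Rightarrow> ('n rfun \<Rightarrow> 'n rfun) set \<Rightarrow> complex^'n \<Rightarrow> ('n rfun \<Rightarrow> complex) set" where
  "fiber X L x0 = {(\<lambda>f. if f \<in> coord_ring X then D f x0 else 0) | D. D \<in> L}"

definition fg_module :: "(complex^'n::finite) set \<Rightarrow> ('n rfun \<Rightarrow> 'n rfun) set \<Rightarrow> bool" where
  "fg_module X L \<longleftrightarrow> (\<exists>G. finite G \<and>
     L = {(\<lambda>f x. \<Sum>D\<in>G. c D x * D f x) | c. \<forall>D\<in>G. c D \<in> coord_ring X})"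

end

theory Submission
  imports Defs "HOL-Library.Function_Algebras" "HOL-Library.Countable_Set"
    "HOL-Computational_Algebra.Fundamental_Theorem_Algebra"
begin

text \<open>
  Let \<open>W\<close> be the largest \<open>\<complex>[X]\<close>-submodule of \<open>VF_alg X Y\<close> inside \<open>Lie_alg X Y\<close>. It contains \<open>L\<close>
  and is stable under the automorphisms of the pair, so its fiber at \<open>x\<^sub>0\<close> is the whole tangent
  space. Gaussian elimination inside \<open>W\<close> yields fields \<open>F\<^sub>b\<close> and functions \<open>G\<^sub>c\<close> with
  \<open>F\<^sub>b G\<^sub>c = \<delta>\<^sub>b\<^sub>c h\<close> and \<open>h(x\<^sub>0) \<noteq> 0\<close>, as many as the dimension of the tangent space. By homogeneity
  that dimension is the same at every point of \<open>X - Y\<close>, so \<open>h D - \<Sum>\<^sub>b D(G\<^sub>b) F\<^sub>b\<close> vanishes where \<open>h\<close>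
  does not, for every \<open>D\<close> in \<open>VF_alg X Y\<close>; hence \<open>h\<^sup>2 VF_alg X Y \<subseteq> W\<close>. The ideal of all \<open>g\<close> with
  \<open>g VF_alg X Y \<subseteq> Lie_alg X Y\<close> is invariant under automorphisms, so its zero set lies in \<open>Y\<close>, and
  the Nullstellensatz together with the Hilbert basis theorem shows that it contains a power of
  the ideal of \<open>Y\<close>.
\<close>

section \<open>Ideals of subrings and the Hilbert basis theorem\<close>

text \<open>The module \<open>W\<close> is stable although \<open>L\<close> need not be: an
  automorphism of the pair carries integral curves to integral curves, hence complete fields to
  complete fields, and it respects brackets and, up to a pullback of the coefficient, multiplication
  by functions. The two factors \<open>h\<close> have different origins. Elimination is carried out
  without division, so the first \<open>h\<close> collects the pivots as a common denominator. The
  comparison of dimensions works only where the \<open>F_b\<close> are independent, that is where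
  \<open>h\<close> is nonzero; the second \<open>h\<close> makes the identity true at the zeros of
  \<open>h\<close> as well. The ideal of multipliers has no reason to be radical, so its zero set
  controls only powers: the Nullstellensatz gives an exponent for each element, and finite
  generation turns these into one uniform exponent.\<close>

definition subring_of :: "'a::comm_ring_1 set \<Rightarrow> bool" where
  "subring_of A \<longleftrightarrow> 1 \<in> A \<and> - 1 \<in> A \<and> (\<forall>a\<in>A. \<forall>b\<in>A. a + b \<in> A \<and> a * b \<in> A)"

definition ideal_of :: "'a::comm_ring_1 set \<Rightarrow> 'a set \<Rightarrow> bool" where
  "ideal_of A I \<longleftrightarrow> I \<subseteq> A \<and> 0 \<in> I \<and> (\<forall>a\<in>I. \<forall>b\<in>I. a + b \<in> I) \<and> (\<forall>r\<in>A. \<forall>a\<in>I. r * a \<in> I)"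

text \<open>
  Finite generation of \<open>I\<close> by \<open>G\<close> is phrased as minimality of \<open>I\<close> among the ideals containing \<open>G\<close>,
  which avoids linear combinations in the proof of the basis theorem.
\<close>

definition noetherian_of :: "'a::comm_ring_1 set \<Rightarrow> bool" where
  "noetherian_of A \<longleftrightarrow> (\<forall>I. ideal_of A I \<longrightarrow>
     (\<exists>G. finite G \<and> G \<subseteq> I \<and> (\<forall>K. ideal_of A K \<longrightarrow> G \<subseteq> K \<longrightarrow> I \<subseteq> K)))"

lemma subring_of_simps:
  assumes "subring_of A"
  shows "1 \<in> A" "0 \<in> A" "a \<in> A \<Longrightarrow> b \<in> A \<Longrightarrow> a + b \<in> A" "a \<in> A \<Longrightarrow> b \<in> A \<Longrightarrow> a * b \<in> A"
    "a \<in> A \<Longrightarrow> - a \<in> A" "a \<in> A \<Longrightarrow> b \<in> A \<Longrightarrow> a - b \<in> A" "a \<in> A \<Longrightarrow> a ^ n \<in> A"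
proof -
  show 1: "1 \<in> A" and add: "\<And>a b. a \<in> A \<Longrightarrow> b \<in> A \<Longrightarrow> a + b \<in> A"
    and mult: "\<And>a b. a \<in> A \<Longrightarrow> b \<in> A \<Longrightarrow> a * b \<in> A"
    using assms by (auto simp: subring_of_def)
  have m1: "- 1 \<in> A" using assms by (simp add: subring_of_def)
  show neg: "- a \<in> A" if "a \<in> A" for a using mult[OF m1 that] by simp
  show "0 \<in> A" using add[OF 1 m1] by simp
  show "a - b \<in> A" if "a \<in> A" "b \<in> A" for a b using add[OF that(1) neg[OF that(2)]] by simp
  show "a ^ n \<in> A" if "a \<in> A" for a by (induction n) (auto simp: 1 mult that)
qed

lemma ideal_of_simps:
  assumes "ideal_of A I"
  shows "0 \<in> I" "a \<in> I \<Longrightarrow> a \<in> A" "a \<in> I \<Longrightarrow> b \<in> I \<Longrightarrow> a + b \<in> I" "r \<in> A \<Longrightarrow> a \<in> I \<Longrightarrow> r * a \<in> I"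
    "r \<in> A \<Longrightarrow> a \<in> I \<Longrightarrow> a * r \<in> I"
  using assms by (auto simp: ideal_of_def mult.commute)

lemma ideal_of_minus:
  assumes "subring_of A" "ideal_of A I"
  shows "a \<in> I \<Longrightarrow> - a \<in> I" "a \<in> I \<Longrightarrow> b \<in> I \<Longrightarrow> a - b \<in> I"
proof -
  have m1: "- 1 \<in> A" using assms by (simp add: subring_of_def)
  show neg: "- a \<in> I" if "a \<in> I" for a
    using ideal_of_simps(4)[OF assms(2) m1 that] by simp
  show "a - b \<in> I" if "a \<in> I" "b \<in> I"
    using ideal_of_simps(3)[OF assms(2) that(1) neg[OF that(2)]] by simp
qed

lemma ideal_of_sum:
  assumes "ideal_of A I" "\<And>i. i \<in> S \<Longrightarrow> f i \<in> I"
  shows "sum f S \<in> I"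
  using assms(2) by (induction S rule: infinite_finite_induct) (auto simp: ideal_of_simps[OF assms(1)])

lemma ideal_of_Int: "ideal_of A I \<Longrightarrow> ideal_of A K \<Longrightarrow> ideal_of A (I \<inter> K)"
  by (auto simp: ideal_of_def)

lemma ideal_of_insert:
  assumes "subring_of A" "ideal_of A I" "g \<in> A"
  shows "ideal_of A {a * g + f | a f. a \<in> A \<and> f \<in> I}"
  unfolding ideal_of_def
proof (intro conjI ballI)
  note [simp] = subring_of_simps[OF assms(1)] ideal_of_simps[OF assms(2)] assms(3)
  show "{a * g + f |a f. a \<in> A \<and> f \<in> I} \<subseteq> A" by auto
  show "0 \<in> {a * g + f |a f. a \<in> A \<and> f \<in> I}"
    by (rule CollectI, rule exI[of _ 0], rule exI[of _ 0]) simp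
  fix u assume "u \<in> {a * g + f |a f. a \<in> A \<and> f \<in> I}"
  then obtain a f where u: "u = a * g + f" "a \<in> A" "f \<in> I" by auto
  show "u + v \<in> {a * g + f |a f. a \<in> A \<and> f \<in> I}" if "v \<in> {a * g + f |a f. a \<in> A \<and> f \<in> I}" for v
  proof -
    from that obtain b e where v: "v = b * g + e" "b \<in> A" "e \<in> I" by auto
    show ?thesis
      by (rule CollectI, rule exI[of _ "a + b"], rule exI[of _ "f + e"]) (simp add: u v algebra_simps)
  qed
  show "r * u \<in> {a * g + f |a f. a \<in> A \<and> f \<in> I}" if "r \<in> A" for r
    by (rule CollectI, rule exI[of _ "r * a"], rule exI[of _ "r * f"]) (simp add: u that algebra_simps)
qed

text \<open>Expand a product of \<open>i + j\<close> factors \<open>a * g + f\<close>: every term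
  contains \<open>i\<close> factors \<open>g\<close> or \<open>j\<close> factors from
  \<open>I\<close>. The prefix \<open>c\<close> accumulates the choices already made, so that
  peeling off one factor lowers \<open>i\<close> or \<open>j\<close>.\<close>

lemma prod_list_mem_ideal_insert:
  assumes A: "subring_of A" and J: "ideal_of A J" and I: "I \<subseteq> A" and g: "g \<in> A"
    and "length fs = i + j" "set fs \<subseteq> {a * g + f | a f. a \<in> A \<and> f \<in> I}" "c \<in> A"
    and "c * g ^ i \<in> J" and "\<And>gs. length gs = j \<Longrightarrow> set gs \<subseteq> I \<Longrightarrow> c * prod_list gs \<in> J"
  shows "c * prod_list fs \<in> J"
  using assms(5-)
proof (induction fs arbitrary: i j c)
  case Nil
  then show ?case by simp
next
  case (Cons u fs)
  note A_simps = subring_of_simps[OF A] and J_simps = ideal_of_simps[OF J]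
  obtain a f where u: "u = a * g + f" "a \<in> A" "f \<in> I" using Cons.prems(2) by auto
  have fs: "set fs \<subseteq> {a * g + f | a f. a \<in> A \<and> f \<in> I}" using Cons.prems(2) by auto
  then have "set fs \<subseteq> A" using I g by (auto intro!: A_simps)
  then have pA: "prod_list fs \<in> A" by (induction fs) (auto intro: A_simps)
  have uA: "u \<in> A" using u I g by (auto intro!: A_simps)
  show ?case
  proof (cases "i = 0 \<or> j = 0")
    case True
    \<comment> \<open>An exhausted count decides: for \<open>i = 0\<close> the hypothesis on
      \<open>g ^ i\<close>, for \<open>j = 0\<close> the one on the empty list, puts
      \<open>c\<close> into \<open>J\<close>.\<close>
    then have "c \<in> J" using Cons.prems(4) Cons.prems(5)[of "[]"] by auto
    then show ?thesis using J_simps(5) A_simps(4) uA pA by simp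
  next
    case False
    then obtain i' j' where ij: "i = Suc i'" "j = Suc j'" by (metis not0_implies_Suc)
    have "c * g * prod_list fs \<in> J"
    proof (rule Cons.IH[where i = i' and j = j])
      show "length fs = i' + j" using Cons.prems(1) ij by simp
      show "c * g \<in> A" using Cons.prems(3) g A_simps by simp
      show "c * g * g ^ i' \<in> J" using Cons.prems(4) ij by (simp add: ac_simps)
      show "c * g * prod_list gs \<in> J" if "length gs = j" "set gs \<subseteq> I" for gs
        using J_simps(4)[OF g Cons.prems(5)[OF that]] by (simp add: ac_simps)
    qed (rule fs)
    moreover have "c * f * prod_list fs \<in> J"
    proof (rule Cons.IH[where i = i and j = j'])
      have fA: "f \<in> A" using u I by auto
      show "length fs = i + j'" using Cons.prems(1) ij by simp
      show "c * f \<in> A" using Cons.prems(3) fA A_simps by simp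
      show "c * f * g ^ i \<in> J" using J_simps(4)[OF fA Cons.prems(4)] by (simp add: ac_simps)
      show "c * f * prod_list gs \<in> J" if "length gs = j'" "set gs \<subseteq> I" for gs
        using Cons.prems(5)[of "f # gs"] that u ij by (simp add: ac_simps)
    qed (rule fs)
    ultimately have "a * (c * g * prod_list fs) + c * f * prod_list fs \<in> J"
      using J_simps u by blast
    then show ?thesis by (simp add: u algebra_simps)
  qed
qed

text \<open>A further generator \<open>g\<close> with \<open>g ^ n\<close> in \<open>J\<close>
  raises the exponent from \<open>N\<close> to \<open>n + N\<close>, by the expansion above. The
  result is an ideal around \<open>G\<close>, because that is what generation phrased as minimality
  can be applied to.\<close>

lemma finite_nilpotent_imp_ideal_pow_subset:
  assumes A: "subring_of A" and J: "ideal_of A J" and "finite G" "G \<subseteq> A"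
    and "\<And>g. g \<in> G \<Longrightarrow> \<exists>n. g ^ n \<in> J"
  shows "\<exists>I N. ideal_of A I \<and> G \<subseteq> I \<and> (\<forall>fs. length fs = N \<longrightarrow> set fs \<subseteq> I \<longrightarrow> prod_list fs \<in> J)"
  using assms(3-)
proof (induction G rule: finite_induct)
  case empty
  \<comment> \<open>Exponent 0 would ask for the empty product 1 in \<open>J\<close>, so the zero
    ideal takes exponent 1.\<close>
  have "prod_list fs \<in> J" if "length fs = 1" "set fs \<subseteq> {0}" for fs
    using that ideal_of_simps(1)[OF J] by (cases fs) auto
  moreover have "ideal_of A {0}"
    using subring_of_simps[OF A] by (auto simp: ideal_of_def)
  ultimately show ?case by blast
next
  case (insert g G)
  then obtain I N where I: "ideal_of A I" "G \<subseteq> I"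
    and N: "\<And>fs. length fs = N \<Longrightarrow> set fs \<subseteq> I \<Longrightarrow> prod_list fs \<in> J" by auto
  obtain n where n: "g ^ n \<in> J" using insert.prems by blast
  let ?I = "{a * g + f | a f. a \<in> A \<and> f \<in> I}"
  have gA: "g \<in> A" using insert.prems by auto
  have "g \<in> ?I"
    by (rule CollectI, rule exI[of _ 1], rule exI[of _ 0])
      (simp add: subring_of_simps[OF A] ideal_of_simps[OF I(1)])
  moreover have "f \<in> ?I" if "f \<in> G" for f
    by (rule CollectI, rule exI[of _ 0], rule exI[of _ f])
      (use that I in \<open>auto simp: subring_of_simps[OF A]\<close>)
  moreover have "prod_list fs \<in> J" if "length fs = n + N" "set fs \<subseteq> ?I" for fs
    using prod_list_mem_ideal_insert[OF A J _ gA that, of 1] N n I(1) subring_of_simps(1)[OF A]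
    by (auto simp: ideal_of_def)
  ultimately show ?case
    using ideal_of_insert[OF A I(1) gA] by blast
qed

lemma noetherian_imp_ideal_pow_subset:
  assumes A: "subring_of A" "noetherian_of A" and J: "ideal_of A J" and I: "ideal_of A I"
    and nil: "\<And>g. g \<in> I \<Longrightarrow> \<exists>n. g ^ n \<in> J"
  shows "\<exists>N. \<forall>fs. length fs = N \<longrightarrow> set fs \<subseteq> I \<longrightarrow> prod_list fs \<in> J"
proof -
  obtain G where G: "finite G" "G \<subseteq> I" "\<And>K. ideal_of A K \<Longrightarrow> G \<subseteq> K \<Longrightarrow> I \<subseteq> K"
    using A(2)[unfolded noetherian_of_def, rule_format, OF I] by metis
  have "G \<subseteq> A" using G(2) I by (auto simp: ideal_of_def)
  moreover have "\<exists>n. g ^ n \<in> J" if "g \<in> G" for g using nil G(2) that by blast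
  ultimately obtain K N where K: "ideal_of A K" "G \<subseteq> K"
    and N: "\<And>fs. length fs = N \<Longrightarrow> set fs \<subseteq> K \<Longrightarrow> prod_list fs \<in> J"
    using finite_nilpotent_imp_ideal_pow_subset[OF A(1) J G(1)] by metis
  have "I \<subseteq> K" by (rule G(3)[OF K])
  then have "prod_list fs \<in> J" if "length fs = N" "set fs \<subseteq> I" for fs
    using N[of fs] that by blast
  then show ?thesis by blast
qed

text \<open>
  Elements of \<open>A[t]\<close> need not have unique coefficients here: \<open>t\<close> is an arbitrary ring element.
\<close>

definition polys_below :: "'a::comm_ring_1 set \<Rightarrow> 'a \<Rightarrow> nat \<Rightarrow> 'a set" where
  "polys_below A t n = {\<Sum>k<n. a k * t ^ k | a. \<forall>k. a k \<in> A}"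

definition adjoin :: "'a::comm_ring_1 set \<Rightarrow> 'a \<Rightarrow> 'a set" where
  "adjoin A t = (\<Union>n. polys_below A t n)"

definition lead_coeffs :: "'a::comm_ring_1 set \<Rightarrow> 'a \<Rightarrow> 'a set \<Rightarrow> nat \<Rightarrow> 'a set" where
  "lead_coeffs A t I n = {a \<in> A. \<exists>g\<in>polys_below A t n. a * t ^ n + g \<in> I}"

context
  fixes A :: "'a::comm_ring_1 set" and t :: 'a
  assumes A: "subring_of A"
begin

lemma polys_below_zero: "0 \<in> polys_below A t n"
  by (auto simp: polys_below_def subring_of_simps[OF A] intro!: exI[of _ "\<lambda>_. 0"])

lemma polys_below_add:
  assumes "u \<in> polys_below A t n" "v \<in> polys_below A t n" shows "u + v \<in> polys_below A t n"
proof -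
  obtain a b where "u = (\<Sum>k<n. a k * t ^ k)" "\<forall>k. a k \<in> A" "v = (\<Sum>k<n. b k * t ^ k)" "\<forall>k. b k \<in> A"
    using assms by (auto simp: polys_below_def)
  then show ?thesis
    by (auto simp: polys_below_def subring_of_simps[OF A] sum.distrib algebra_simps
        intro!: exI[of _ "\<lambda>k. a k + b k"])
qed

lemma polys_below_smult:
  assumes "c \<in> A" "u \<in> polys_below A t n" shows "c * u \<in> polys_below A t n"
proof -
  obtain a where "u = (\<Sum>k<n. a k * t ^ k)" "\<forall>k. a k \<in> A"
    using assms by (auto simp: polys_below_def)
  then show ?thesis using assms(1)
    by (auto simp: polys_below_def subring_of_simps[OF A] sum_distrib_left algebra_simps
        intro!: exI[of _ "\<lambda>k. c * a k"])
qed

lemma polys_below_Suc_iff: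
  "f \<in> polys_below A t (Suc n) \<longleftrightarrow> (\<exists>a\<in>A. \<exists>g\<in>polys_below A t n. f = a * t ^ n + g)"
proof
  assume "f \<in> polys_below A t (Suc n)"
  then show "\<exists>a\<in>A. \<exists>g\<in>polys_below A t n. f = a * t ^ n + g"
    by (fastforce simp: polys_below_def add.commute)
next
  assume "\<exists>a\<in>A. \<exists>g\<in>polys_below A t n. f = a * t ^ n + g"
  then obtain a b where ab: "a \<in> A" "\<forall>k. b k \<in> A" "f = a * t ^ n + (\<Sum>k<n. b k * t ^ k)"
    by (auto simp: polys_below_def)
  then show "f \<in> polys_below A t (Suc n)"
    by (auto simp: polys_below_def add.commute intro!: exI[of _ "b(n := a)"] sum.cong)
qed

lemma polys_below_mono: "m \<le> n \<Longrightarrow> polys_below A t m \<subseteq> polys_below A t n"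
proof (induction n rule: dec_induct)
  case (step n)
  have "f \<in> polys_below A t (Suc n)" if "f \<in> polys_below A t n" for f
    unfolding polys_below_Suc_iff
    by (rule bexI[of _ 0], rule bexI[of _ f]) (simp_all add: that subring_of_simps[OF A])
  then show ?case using step by blast
qed simp

lemma polys_below_shift: "f \<in> polys_below A t n \<Longrightarrow> t * f \<in> polys_below A t (Suc n)"
proof (induction n arbitrary: f)
  case 0
  then have "f = 0" by (auto simp: polys_below_def)
  then show ?case using polys_below_zero by simp
next
  case (Suc n)
  then obtain a g where "a \<in> A" "g \<in> polys_below A t n" "f = a * t ^ n + g"
    by (auto simp: polys_below_Suc_iff)
  then have "a \<in> A" "t * g \<in> polys_below A t (Suc n)" "t * f = a * t ^ Suc n + t * g"
    using Suc.IH[of g] by (auto simp: algebra_simps)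
  then show ?case by (subst polys_below_Suc_iff) blast
qed

lemma adjoin_add: "u \<in> adjoin A t \<Longrightarrow> v \<in> adjoin A t \<Longrightarrow> u + v \<in> adjoin A t"
proof -
  assume "u \<in> adjoin A t" "v \<in> adjoin A t"
  then obtain m n where "u \<in> polys_below A t m" "v \<in> polys_below A t n" by (auto simp: adjoin_def)
  then have "u \<in> polys_below A t (max m n)" "v \<in> polys_below A t (max m n)"
    using polys_below_mono[of m "max m n"] polys_below_mono[of n "max m n"] by auto
  then show "u + v \<in> adjoin A t" using polys_below_add by (auto simp: adjoin_def)
qed

lemma adjoin_base: "A \<subseteq> adjoin A t"
proof
  fix a assume a: "a \<in> A"
  then have "a \<in> polys_below A t (Suc 0)"
    by (auto simp: polys_below_def intro!: exI[of _ "\<lambda>_. a"])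
  then show "a \<in> adjoin A t" by (auto simp: adjoin_def)
qed

lemma adjoin_smult: "a \<in> A \<Longrightarrow> f \<in> adjoin A t \<Longrightarrow> a * f \<in> adjoin A t"
  using polys_below_smult by (auto simp: adjoin_def)

lemma adjoin_shift: "f \<in> adjoin A t \<Longrightarrow> t * f \<in> adjoin A t"
  using polys_below_shift by (auto simp: adjoin_def)

lemma adjoin_generator: "t \<in> adjoin A t"
  using adjoin_shift[of 1] adjoin_base subring_of_simps(1)[OF A] by auto

lemma adjoin_power_mult: "f \<in> adjoin A t \<Longrightarrow> t ^ n * f \<in> adjoin A t"
  by (induction n) (auto simp: mult.assoc intro: adjoin_shift)

lemma adjoin_mult: assumes "f \<in> adjoin A t" "g \<in> adjoin A t" shows "f * g \<in> adjoin A t"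
proof -
  obtain n where "f \<in> polys_below A t n" using assms by (auto simp: adjoin_def)
  then show ?thesis
  proof (induction n arbitrary: f)
    case 0
    then show ?case using adjoin_base subring_of_simps(2)[OF A] by (auto simp: polys_below_def)
  next
    case (Suc n)
    then obtain a h where "a \<in> A" "h \<in> polys_below A t n" "f = a * t ^ n + h"
      by (auto simp: polys_below_Suc_iff)
    then have "f * g = a * (t ^ n * g) + h * g" "a * (t ^ n * g) \<in> adjoin A t" "h * g \<in> adjoin A t"
      using Suc.IH[of h] assms(2) adjoin_smult adjoin_power_mult by (auto simp: algebra_simps)
    then show ?case using adjoin_add by simp
  qed
qed

lemma adjoin_subring: "subring_of (adjoin A t)"
  unfolding subring_of_def
  using adjoin_add adjoin_mult adjoin_base subring_of_simps(1,5)[OF A] by auto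

section \<open>Ideals of leading coefficients and the basis theorem\<close>

lemma lead_coeffs_ideal:
  assumes I: "ideal_of (adjoin A t) I"
  shows "ideal_of A (lead_coeffs A t I n)"
  unfolding ideal_of_def
proof (intro conjI ballI)
  show "lead_coeffs A t I n \<subseteq> A" by (auto simp: lead_coeffs_def)
  show "0 \<in> lead_coeffs A t I n"
    using polys_below_zero ideal_of_simps(1)[OF I] subring_of_simps[OF A]
    by (auto simp: lead_coeffs_def intro!: bexI[of _ 0])
  fix a assume "a \<in> lead_coeffs A t I n"
  then obtain g where a: "a \<in> A" "g \<in> polys_below A t n" "a * t ^ n + g \<in> I"
    by (auto simp: lead_coeffs_def)
  show "a + b \<in> lead_coeffs A t I n" if "b \<in> lead_coeffs A t I n" for b
  proof -
    from that obtain h where b: "b \<in> A" "h \<in> polys_below A t n" "b * t ^ n + h \<in> I"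
      by (auto simp: lead_coeffs_def)
    have "(a * t ^ n + g) + (b * t ^ n + h) \<in> I" using a b ideal_of_simps[OF I] by simp
    then show ?thesis using a b polys_below_add subring_of_simps[OF A]
      by (auto simp: lead_coeffs_def algebra_simps intro!: bexI[of _ "g + h"])
  qed
  show "r * a \<in> lead_coeffs A t I n" if "r \<in> A" for r
  proof -
    have "r * (a * t ^ n + g) \<in> I" using a that adjoin_base ideal_of_simps(4)[OF I] by blast
    then show ?thesis using a that polys_below_smult subring_of_simps[OF A]
      by (auto simp: lead_coeffs_def algebra_simps intro!: bexI[of _ "r * g"])
  qed
qed

lemma lead_coeffs_mono:
  assumes I: "ideal_of (adjoin A t) I" and "m \<le> n"
  shows "lead_coeffs A t I m \<subseteq> lead_coeffs A t I n"
  using assms(2)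
proof (induction n rule: dec_induct)
  case (step n)
  have "a \<in> lead_coeffs A t I (Suc n)" if "a \<in> lead_coeffs A t I n" for a
  proof -
    from that obtain g where a: "a \<in> A" "g \<in> polys_below A t n" "a * t ^ n + g \<in> I"
      by (auto simp: lead_coeffs_def)
    then have "t * (a * t ^ n + g) \<in> I" using adjoin_generator ideal_of_simps(4)[OF I] by blast
    then show ?thesis using a polys_below_shift
      by (auto simp: lead_coeffs_def algebra_simps intro!: bexI[of _ "t * g"])
  qed
  then show ?case using step by blast
qed simp

text \<open>Descent on the degree: from \<open>f\<close> in \<open>I\<close> subtract an element of
  \<open>K\<close> with the same leading coefficient. \<open>K \<subseteq> I\<close> keeps the
  difference in \<open>I\<close>, and its degree is lower.\<close>

lemma ideal_subset_if_lead_coeffs_subset: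
  assumes I: "ideal_of (adjoin A t) I" and K: "ideal_of (adjoin A t) K" and "K \<subseteq> I"
    and lead: "\<And>n. lead_coeffs A t I n \<subseteq> lead_coeffs A t K n"
  shows "I \<subseteq> K"
proof -
  have "f \<in> K" if "f \<in> polys_below A t n" "f \<in> I" for f n
    using that
  proof (induction n arbitrary: f)
    case 0
    then show ?case using ideal_of_simps(1)[OF K] by (simp add: polys_below_def)
  next
    case (Suc n)
    then obtain a g where f: "a \<in> A" "g \<in> polys_below A t n" "f = a * t ^ n + g"
      by (auto simp: polys_below_Suc_iff)
    then have "a \<in> lead_coeffs A t K n" using Suc.prems lead by (auto simp: lead_coeffs_def)
    then obtain h where h: "h \<in> polys_below A t n" "a * t ^ n + h \<in> K"
      by (auto simp: lead_coeffs_def)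
    have "f - (a * t ^ n + h) \<in> I"
      using ideal_of_minus(2)[OF adjoin_subring I] Suc.prems h \<open>K \<subseteq> I\<close> by blast
    moreover have "f - (a * t ^ n + h) = g + (- 1) * h" by (simp add: f)
    moreover have "g + (- 1) * h \<in> polys_below A t n"
      using f h subring_of_simps(1,5)[OF A] by (intro polys_below_add polys_below_smult) auto
    ultimately have "f - (a * t ^ n + h) \<in> K" using Suc.IH by metis
    then have "(f - (a * t ^ n + h)) + (a * t ^ n + h) \<in> K"
      using h(2) ideal_of_simps(3)[OF K] by blast
    then show ?case by simp
  qed
  then show ?thesis using I by (auto simp: ideal_of_def adjoin_def)
qed

theorem hilbert_basis:
  assumes noeth: "noetherian_of A"
  shows "noetherian_of (adjoin A t)"
  unfolding noetherian_of_def
proof (intro allI impI)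
  fix I assume I: "ideal_of (adjoin A t) I"
  let ?L = "lead_coeffs A t I"
  have fg: "\<exists>G. finite G \<and> G \<subseteq> M \<and> (\<forall>K. ideal_of A K \<longrightarrow> G \<subseteq> K \<longrightarrow> M \<subseteq> K)"
    if "ideal_of A M" for M
    using noeth[unfolded noetherian_of_def, rule_format, OF that] .
  have "ideal_of A (\<Union>n. ?L n)"
    unfolding ideal_of_def
  proof (intro conjI ballI)
    note L = lead_coeffs_ideal[OF I]
    show "(\<Union>n. ?L n) \<subseteq> A" by (auto simp: lead_coeffs_def)
    show "0 \<in> (\<Union>n. ?L n)" using ideal_of_simps(1)[OF L] by blast
    show "r * a \<in> (\<Union>n. ?L n)" if "r \<in> A" "a \<in> (\<Union>n. ?L n)" for r a
      using that ideal_of_simps(4)[OF L] by blast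
    show "a + b \<in> (\<Union>n. ?L n)" if "a \<in> (\<Union>n. ?L n)" "b \<in> (\<Union>n. ?L n)" for a b
    proof -
      from that obtain m n where "a \<in> ?L m" "b \<in> ?L n" by auto
      then have "a \<in> ?L (max m n)" "b \<in> ?L (max m n)"
        using lead_coeffs_mono[OF I] by (meson max.cobounded1 max.cobounded2 subsetD)+
      then show ?thesis using ideal_of_simps(3)[OF L] by blast
    qed
  qed
  from fg[OF this] obtain G where G: "finite G" "G \<subseteq> (\<Union>n. ?L n)"
    "\<And>K. ideal_of A K \<Longrightarrow> G \<subseteq> K \<Longrightarrow> (\<Union>n. ?L n) \<subseteq> K" by blast
  \<comment> \<open>The ideals \<open>?L n\<close> increase, so their finitely generated union is
    reached at one index.\<close>
  have "\<exists>N. G \<subseteq> ?L N"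
    using G(1,2)
  proof (induction G rule: finite_induct)
    case (insert g G)
    then obtain m n where "G \<subseteq> ?L m" "g \<in> ?L n" by auto
    then have "insert g G \<subseteq> ?L (max m n)"
      using lead_coeffs_mono[OF I, of m "max m n"] lead_coeffs_mono[OF I, of n "max m n"] by auto
    then show ?case by blast
  qed simp
  then obtain N where N: "\<And>n. ?L n \<subseteq> ?L N" using G(3)[OF lead_coeffs_ideal[OF I]] by blast
  obtain Gs where Gs: "\<And>n. finite (Gs n)" "\<And>n. Gs n \<subseteq> ?L n"
    "\<And>n K. ideal_of A K \<Longrightarrow> Gs n \<subseteq> K \<Longrightarrow> ?L n \<subseteq> K"
    using fg[OF lead_coeffs_ideal[OF I]] by metis
  have "\<forall>n. \<forall>a\<in>Gs n. \<exists>f\<in>I. \<exists>g\<in>polys_below A t n. f = a * t ^ n + g"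
    using Gs(2) by (force simp: lead_coeffs_def)
  then obtain F where F: "\<And>n a. a \<in> Gs n \<Longrightarrow> F n a \<in> I"
    "\<And>n a. a \<in> Gs n \<Longrightarrow> \<exists>g\<in>polys_below A t n. F n a = a * t ^ n + g"
    by metis
  \<comment> \<open>Lifts of generators up to degree \<open>N\<close> suffice, since beyond
    \<open>N\<close> the ideals \<open>?L n\<close> no longer grow.\<close>
  define S where "S = (\<Union>n\<in>{..N}. F n ` Gs n)"
  have "I \<subseteq> K" if K: "ideal_of (adjoin A t) K" "S \<subseteq> K" for K
  proof -
    \<comment> \<open>An ideal \<open>K\<close> containing \<open>S\<close> need not lie in
      \<open>I\<close>, whereas the descent compares \<open>I\<close> with a smaller ideal.\<close>
    have KI: "ideal_of (adjoin A t) (I \<inter> K)" using ideal_of_Int I K(1) by blast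
    have low: "?L n \<subseteq> lead_coeffs A t (I \<inter> K) n" if "n \<le> N" for n
    proof (rule Gs(3)[OF lead_coeffs_ideal[OF KI]], rule subsetI)
      fix a assume a: "a \<in> Gs n"
      then have "F n a \<in> S" using that unfolding S_def by blast
      then have "F n a \<in> I \<inter> K" using F(1)[OF a] K(2) by blast
      then show "a \<in> lead_coeffs A t (I \<inter> K) n"
        using F(2)[OF a] a Gs(2)[of n] by (auto simp: lead_coeffs_def)
    qed
    have "?L n \<subseteq> lead_coeffs A t (I \<inter> K) n" for n
    proof (cases "n \<le> N")
      case False
      then show ?thesis
        using N[of n] low[of N] lead_coeffs_mono[OF KI, of N n] by (meson linear order_refl subset_trans)
    qed (rule low)
    then show ?thesis using ideal_subset_if_lead_coeffs_subset[OF I KI] by blast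
  qed
  moreover have "finite S" "S \<subseteq> I" using Gs(1) F(1) by (auto simp: S_def)
  ultimately show "\<exists>G. finite G \<and> G \<subseteq> I \<and> (\<forall>K. ideal_of (adjoin A t) K \<longrightarrow> G \<subseteq> K \<longrightarrow> I \<subseteq> K)"
    by blast
qed

lemma adjoin_least: "subring_of B \<Longrightarrow> A \<subseteq> B \<Longrightarrow> t \<in> B \<Longrightarrow> adjoin A t \<subseteq> B"
proof -
  assume B: "subring_of B" "A \<subseteq> B" "t \<in> B"
  have "f \<in> B" if "f \<in> polys_below A t n" for f n
    using that
  proof (induction n arbitrary: f)
    case 0
    then show ?case using subring_of_simps[OF B(1)] by (simp add: polys_below_def)
  next
    case (Suc n)
    then show ?case using B subring_of_simps[OF B(1)] by (auto simp: polys_below_Suc_iff)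
  qed
  then show ?thesis by (auto simp: adjoin_def)
qed

end

section \<open>Noetherianity of the polynomial functions\<close>

lemma poly_fun_subring: "subring_of (poly_fun :: 'n::finite rfun set)"
  unfolding subring_of_def
  using pconst[of 1] pconst[of "-1"] padd pmult
  by (auto simp: one_fun_def fun_Compl_def plus_fun_def times_fun_def)

text \<open>Start from the constants and adjoin the coordinates one at a time. The bound
  \<open>A \<subseteq> poly_fun\<close> travels along, so that the last ring, which contains all
  generators, equals \<open>poly_fun\<close>.\<close>

theorem poly_fun_noetherian: "noetherian_of (poly_fun :: 'n::finite rfun set)"
proof -
  have "\<exists>A. subring_of A \<and> noetherian_of A \<and> range (\<lambda>c x. c) \<subseteq> A \<and> (\<lambda>i x. x $ i) ` V \<subseteq> A \<and> A \<subseteq> poly_fun"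
    if "finite V" for V :: "'n set"
    using that
  proof (induction V rule: finite_induct)
    case empty
    let ?C = "range (\<lambda>c x. c) :: 'n rfun set"
    have "subring_of ?C"
      by (auto simp: subring_of_def one_fun_def fun_Compl_def plus_fun_def times_fun_def image_iff)
    moreover have "noetherian_of ?C"
      unfolding noetherian_of_def
    proof (intro allI impI)
      fix I assume I: "ideal_of ?C I"
      show "\<exists>G. finite G \<and> G \<subseteq> I \<and> (\<forall>K. ideal_of ?C K \<longrightarrow> G \<subseteq> K \<longrightarrow> I \<subseteq> K)"
      proof (cases "I \<subseteq> {0}")
        case True
        then show ?thesis by (intro exI[of _ "{}"]) (auto simp: ideal_of_def)
      next
        case False
        \<comment> \<open>The constants form a field, so one nonzero member generates
          \<open>I\<close>.\<close>
        then obtain c where c: "(\<lambda>x. c) \<in> I" "c \<noteq> 0"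
          using I by (auto simp: ideal_of_def zero_fun_def) blast
        have "f \<in> K" if K: "ideal_of ?C K" "(\<lambda>x. c) \<in> K" "f \<in> I" for K f
        proof -
          obtain d where d: "f = (\<lambda>x. d)" using K I by (auto simp: ideal_of_def)
          have "(\<lambda>x. d / c) * (\<lambda>x. c) \<in> K" by (rule ideal_of_simps(4)[OF K(1) _ K(2)]) simp
          then show ?thesis using c d by (simp add: times_fun_def)
        qed
        then show ?thesis using c by (intro exI[of _ "{\<lambda>x. c}"]) auto
      qed
    qed
    ultimately show ?case by (intro exI[of _ ?C]) (auto intro: pconst)
  next
    case (insert i V)
    then obtain A :: "'n rfun set" where A: "subring_of A" "noetherian_of A" "range (\<lambda>c x. c) \<subseteq> A"
      "(\<lambda>i x. x $ i) ` V \<subseteq> A" "A \<subseteq> poly_fun" by blast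
    let ?B = "adjoin A (\<lambda>x. x $ i)"
    have "?B \<subseteq> poly_fun" using adjoin_least[OF A(1) poly_fun_subring A(5)] pcoord by blast
    then show ?case
      using adjoin_subring[OF A(1)] hilbert_basis[OF A(1,2)] adjoin_base[OF A(1)] A adjoin_generator[OF A(1)]
      by (intro exI[of _ ?B]) blast
  qed
  from this[of UNIV] obtain A :: "'n rfun set" where A: "subring_of A" "noetherian_of A" "range (\<lambda>c x. c) \<subseteq> A"
      "range (\<lambda>i x. x $ i) \<subseteq> A" "A \<subseteq> poly_fun" by auto
  have "p \<in> A" if "p \<in> poly_fun" for p
    using that
  proof induction
    case (padd p q)
    then show ?case using subring_of_simps(3)[OF A(1)] by (auto simp: plus_fun_def)
  next
    case (pmult p q)
    then show ?case using subring_of_simps(4)[OF A(1)] by (auto simp: times_fun_def)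
  qed (use A in auto)
  then have "A = poly_fun" using A(5) by blast
  then show ?thesis using A(2) by simp
qed

section \<open>The Nullstellensatz\<close>

text \<open>One vector space structure serves for polynomials, tangent vectors and coordinate
  vectors: all spans and dimension counts are taken in it.\<close>

interpretation fun_space: vector_space "\<lambda>(c::complex) (v::'a \<Rightarrow> complex) x. c * v x"
  by unfold_locales (auto simp: fun_eq_iff algebra_simps)

lemma sum_fun_apply: "(\<Sum>i\<in>S. (f i :: 'a \<Rightarrow> 'b::comm_monoid_add)) x = (\<Sum>i\<in>S. f i x)"
  by (induction S rule: infinite_finite_induct) auto

lemma poly_fun_prod: "(\<And>i. i \<in> S \<Longrightarrow> f i \<in> poly_fun) \<Longrightarrow> (\<lambda>x. \<Prod>i\<in>S. f i x) \<in> poly_fun"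
  by (induction S rule: infinite_finite_induct) (auto intro: pconst pmult)

lemma poly_fun_coord_diff: "(\<lambda>x. x $ i - c) \<in> poly_fun"
  using padd[OF pcoord[of i] pconst[of "- c"]] by simp

lemma poly_fun_poly_coord: "(\<lambda>x. poly p (x $ i)) \<in> poly_fun"
proof (induction p)
  case 0
  then show ?case using pconst[of 0] by simp
next
  case (pCons a p)
  then show ?case using padd[OF pconst[of a] pmult[OF pcoord[of i]]] by simp
qed

definition monomial_fun :: "('n::finite \<Rightarrow> nat) \<Rightarrow> 'n rfun" where
  "monomial_fun e = (\<lambda>x. \<Prod>i\<in>UNIV. x $ i ^ e i)"

lemma monomial_fun_mult: "monomial_fun e * monomial_fun e' = monomial_fun (\<lambda>i. e i + e' i)"
  by (auto simp: monomial_fun_def fun_eq_iff power_add prod.distrib)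

lemma span_monomial_fun_mult:
  assumes "p \<in> fun_space.span (range monomial_fun)" "q \<in> fun_space.span (range monomial_fun)"
  shows "p * q \<in> fun_space.span (range monomial_fun)"
  using assms(1)
proof (induction rule: fun_space.span_induct_alt)
  case base
  show ?case using fun_space.span_zero by (simp add: zero_fun_def)
next
  case (step c m p)
  then obtain e where m: "m = monomial_fun e" by auto
  have "m * q \<in> fun_space.span (range monomial_fun)"
    using assms(2)
  proof (induction rule: fun_space.span_induct_alt)
    case base
    show ?case using fun_space.span_zero by (simp add: zero_fun_def)
  next
    case (step d m' q)
    then obtain e' where "m' = monomial_fun e'" by auto
    then have "m * m' \<in> range monomial_fun" by (simp add: m monomial_fun_mult)
    then have "(\<lambda>x. d * (m * m') x) \<in> fun_space.span (range monomial_fun)"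
      by (intro fun_space.span_scale fun_space.span_base)
    then have "(\<lambda>x. d * (m * m') x) + m * q \<in> fun_space.span (range monomial_fun)"
      using step fun_space.span_add by blast
    moreover have "(\<lambda>x. d * (m * m') x) + m * q = m * ((\<lambda>x. d * m' x) + q)"
      by (auto simp: fun_eq_iff algebra_simps)
    ultimately show ?case by (simp add: times_fun_def plus_fun_def)
  qed
  then have "(\<lambda>x. c * (m * q) x) + p * q \<in> fun_space.span (range monomial_fun)"
    using step fun_space.span_add fun_space.span_scale by blast
  moreover have "(\<lambda>x. c * (m * q) x) + p * q = ((\<lambda>x. c * m x) + p) * q"
    by (auto simp: fun_eq_iff algebra_simps)
  ultimately show ?case by (simp add: times_fun_def plus_fun_def)
qed

text \<open>This is the countable dimension of the polynomial ring: exponent functions on a finite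
  index type are countable in number.\<close>

lemma poly_fun_subset_span_monomial_fun: "poly_fun \<subseteq> fun_space.span (range monomial_fun)"
proof
  fix p :: "'n::finite rfun" assume "p \<in> poly_fun"
  then show "p \<in> fun_space.span (range monomial_fun)"
  proof induction
    case (pconst c)
    have "(\<lambda>x. c * monomial_fun (\<lambda>_. 0) x) \<in> fun_space.span (range monomial_fun)"
      by (intro fun_space.span_scale fun_space.span_base) auto
    then show ?case by (simp add: monomial_fun_def)
  next
    case (pcoord i)
    have "x $ i = (\<Prod>j\<in>UNIV. x $ j ^ (if j = i then 1 else 0))" for x :: "complex^'n"
      by (simp add: prod.delta if_distrib[of "(^) _"] cong: if_cong)
    then have "(\<lambda>x. x $ i) = monomial_fun (\<lambda>j. if j = i then 1 else 0)"
      unfolding monomial_fun_def by blast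
    then show ?case by (metis fun_space.span_base rangeI)
  next
    case (padd p q)
    then show ?case using fun_space.span_add by (auto simp: plus_fun_def)
  next
    case (pmult p q)
    then show ?case using span_monomial_fun_mult by (auto simp: times_fun_def)
  qed
qed

text \<open>Otherwise the uncountable set of complex numbers would be a countable union of finite
  fibers.\<close>

lemma exists_infinite_fiber:
  assumes "countable (range g)"
  shows "\<exists>y. infinite {c::complex. g c = y}"
proof (rule ccontr)
  assume "\<not> ?thesis"
  then have "countable (\<Union>y\<in>range g. {c. g c = y})"
    using assms by (intro countable_UN) (auto intro: countable_finite)
  moreover have "(\<Union>y\<in>range g. {c. g c = y}) = UNIV" by auto
  ultimately show False using uncountable_UNIV_complex by simp
qed

text \<open>Over the complex numbers \<open>p\<close> splits, so a prime ideal containing the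
  product contains a linear factor, unless only a nonzero constant times \<open>u\<close> remains,
  which \<open>u \<notin> P\<close> excludes.\<close>

lemma prime_contains_linear_factor:
  fixes P :: "'n::finite rfun set"
  assumes P: "ideal_of poly_fun P"
    and prime: "\<And>a b. a \<in> poly_fun \<Longrightarrow> b \<in> poly_fun \<Longrightarrow> a * b \<in> P \<Longrightarrow> a \<in> P \<or> b \<in> P"
    and u: "u \<in> poly_fun" "u \<notin> P"
    and "p \<noteq> 0" "(\<lambda>x. poly p (x $ i)) * u \<in> P"
  shows "\<exists>c. (\<lambda>x. x $ i - c) \<in> P"
  using assms(5,6)
proof (induction "degree p" arbitrary: p)
  case 0
  then obtain c where c: "p = [:c:]" "c \<noteq> 0" by (metis degree_0_id of_nat_0 degree_eq_zeroE pCons_0_0)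
  have "(\<lambda>x. 1 / c) * ((\<lambda>x. poly p (x $ i)) * u) \<in> P"
    using ideal_of_simps(4)[OF P pconst 0(3)] .
  moreover have "(\<lambda>x. 1 / c) * ((\<lambda>x. poly p (x $ i)) * u) = u"
    using c by (auto simp: fun_eq_iff)
  ultimately show ?case using u by simp
next
  case (Suc n)
  then have "\<not> constant (poly p)" by (simp add: constant_degree)
  then obtain z where "poly p z = 0" using fundamental_theorem_of_algebra by blast
  then obtain q where q: "p = [:- z, 1:] * q" by (auto simp: poly_eq_0_iff_dvd dvd_def)
  then have "q \<noteq> 0" using Suc by auto
  then have "degree p = Suc (degree q)" unfolding q by (subst degree_mult_eq) auto
  then have "n = degree q" using Suc(2) by simp
  have "(\<lambda>x. x $ i - z) * ((\<lambda>x. poly q (x $ i)) * u) = (\<lambda>x. poly p (x $ i)) * u"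
    by (auto simp: q fun_eq_iff algebra_simps)
  then have "(\<lambda>x. x $ i - z) * ((\<lambda>x. poly q (x $ i)) * u) \<in> P" using Suc.prems by simp
  moreover have "(\<lambda>x. poly q (x $ i)) * u \<in> poly_fun"
    using poly_fun_poly_coord u(1) pmult by (auto simp: times_fun_def)
  ultimately have "(\<lambda>x. x $ i - z) \<in> P \<or> (\<lambda>x. poly q (x $ i)) * u \<in> P"
    using prime[OF poly_fun_coord_diff] by blast
  then show ?case using Suc.hyps(1)[OF \<open>n = degree q\<close> \<open>q \<noteq> 0\<close>] by blast
qed

text \<open>
  The proof uses that \<open>\<complex>\<close> is uncountable. Take \<open>P \<supseteq> J\<close> maximal among the ideals without powers of
  \<open>f\<close>. If \<open>x\<^sub>i - c \<notin> P\<close> for all \<open>c\<close>, then \<open>f\<close> to some power is \<open>q\<^sub>c (x\<^sub>i - c)\<close> modulo \<open>P\<close>; as the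
  polynomials have countable dimension, infinitely many of the \<open>q\<^sub>c\<close> with a common exponent lie in a
  finite-dimensional space, and a linear relation between them puts a nonzero polynomial in \<open>x\<^sub>i\<close>,
  times a power of \<open>f\<close>, into the prime ideal \<open>P\<close>.
\<close>

theorem nullstellensatz:
  fixes J :: "'n::finite rfun set"
  assumes J: "ideal_of poly_fun J" and f: "f \<in> poly_fun"
    and van: "\<And>x. (\<And>g. g \<in> J \<Longrightarrow> g x = 0) \<Longrightarrow> f x = 0"
  shows "\<exists>n. f ^ n \<in> J"
proof (rule ccontr)
  assume nJ: "\<not> ?thesis"
  note R = poly_fun_subring
  note R_simps = subring_of_simps[OF R]
  define \<A> where "\<A> = {P. ideal_of poly_fun P \<and> J \<subseteq> P \<and> (\<forall>n. f ^ n \<notin> P)}"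
  have "\<exists>P\<in>\<A>. \<forall>Q\<in>\<A>. P \<subseteq> Q \<longrightarrow> Q = P"
  proof (rule subset_Zorn_nonempty)
    show "\<A> \<noteq> {}" using J nJ by (auto simp: \<A>_def)
    fix \<C> assume C: "\<C> \<noteq> {}" "subset.chain \<A> \<C>"
    then have CA: "\<And>P. P \<in> \<C> \<Longrightarrow> ideal_of poly_fun P \<and> J \<subseteq> P \<and> (\<forall>n. f ^ n \<notin> P)"
      by (auto simp: subset.chain_def \<A>_def)
    have "ideal_of poly_fun (\<Union>\<C>)"
      unfolding ideal_of_def
    proof (intro conjI ballI)
      show "\<Union>\<C> \<subseteq> poly_fun" using CA ideal_of_simps(2) by blast
      show "0 \<in> \<Union>\<C>" using CA C(1) ideal_of_simps(1) by blast
      show "r * a \<in> \<Union>\<C>" if "r \<in> poly_fun" "a \<in> \<Union>\<C>" for r a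
        using that CA ideal_of_simps(4) by blast
      show "a + b \<in> \<Union>\<C>" if "a \<in> \<Union>\<C>" "b \<in> \<Union>\<C>" for a b
      proof -
        from that obtain P Q where PQ: "P \<in> \<C>" "Q \<in> \<C>" "a \<in> P" "b \<in> Q" by auto
        then have "P \<subseteq> Q \<or> Q \<subseteq> P" using C(2) by (auto simp: subset.chain_def)
        then show ?thesis using PQ CA ideal_of_simps(3) by (metis Union_iff subsetD)
      qed
    qed
    then show "\<Union>\<C> \<in> \<A>" using CA C(1) by (auto simp: \<A>_def)
  qed
  then obtain P where P: "ideal_of poly_fun P" "J \<subseteq> P" "\<And>n. f ^ n \<notin> P"
    and max: "\<And>Q. Q \<in> \<A> \<Longrightarrow> P \<subseteq> Q \<Longrightarrow> Q = P"
    by (auto simp: \<A>_def)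
  note P_simps = ideal_of_simps[OF P(1)] ideal_of_minus[OF R P(1)]
  \<comment> \<open>By maximality, the ideal generated by \<open>P\<close> and \<open>a\<close>
    contains a power of \<open>f\<close>.\<close>
  have ext: "\<exists>n. \<exists>q\<in>poly_fun. f ^ n - q * a \<in> P" if a: "a \<in> poly_fun" "a \<notin> P" for a
  proof (rule ccontr)
    assume neg: "\<not> ?thesis"
    let ?Q = "{q * a + p | q p. q \<in> poly_fun \<and> p \<in> P}"
    have sub: "P \<subseteq> ?Q"
    proof
      fix p assume "p \<in> P"
      then show "p \<in> ?Q"
        by (intro CollectI exI[of _ 0] exI[of _ p]) (simp add: R_simps)
    qed
    have "f ^ n \<notin> ?Q" for n
    proof
      assume "f ^ n \<in> ?Q"
      then obtain q p where "f ^ n = q * a + p" "q \<in> poly_fun" "p \<in> P" by auto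
      moreover from this have "f ^ n - q * a = p" by simp
      ultimately show False using neg by metis
    qed
    then have "?Q \<in> \<A>" using ideal_of_insert[OF R P(1) a(1)] sub P(2) by (auto simp: \<A>_def)
    then have "?Q = P" using max sub by blast
    moreover have "a \<in> ?Q"
      by (intro CollectI exI[of _ 1] exI[of _ 0]) (simp add: R_simps P_simps)
    ultimately show False using a by simp
  qed
  have prime: "a \<in> P \<or> b \<in> P" if ab: "a \<in> poly_fun" "b \<in> poly_fun" "a * b \<in> P" for a b
  proof (rule ccontr)
    assume "\<not> ?thesis"
    then obtain m n q r where q: "q \<in> poly_fun" "f ^ m - q * a \<in> P" and r: "r \<in> poly_fun" "f ^ n - r * b \<in> P"
      using ext ab by metis
    \<comment> \<open>Multiplying \<open>f ^ m = q a\<close> and \<open>f ^ n = r b\<close> modulo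
      \<open>P\<close> gives \<open>f ^ (m + n) = q r a b\<close>, which is 0 modulo
      \<open>P\<close>.\<close>
    have "f ^ n * (f ^ m - q * a) + (q * a * (f ^ n - r * b) + q * r * (a * b)) \<in> P"
      using q r ab f by (intro P_simps(3) P_simps(4)[OF _ q(2)] P_simps(4)[OF _ r(2)] P_simps(4)[OF _ ab(3)] R_simps)
    moreover have "f ^ n * (f ^ m - q * a) + (q * a * (f ^ n - r * b) + q * r * (a * b)) = f ^ (m + n)"
      by (simp add: algebra_simps power_add)
    ultimately show False using P(3) by metis
  qed
  have "\<exists>c. (\<lambda>x. x $ i - c) \<in> P" for i
  proof (rule ccontr)
    assume none: "\<not> ?thesis"
    then have "\<forall>c. \<exists>n. \<exists>q\<in>poly_fun. f ^ n - q * (\<lambda>x. x $ i - c) \<in> P"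
      using ext[OF poly_fun_coord_diff] by blast
    then obtain n q where q: "\<And>c. q c \<in> poly_fun" "\<And>c. f ^ n c - q c * (\<lambda>x. x $ i - c) \<in> P"
      by metis
    \<comment> \<open>Finite sets of monomials are countable in number, while the \<open>q c\<close>
      need not be; so each \<open>q c\<close> is recorded through a set \<open>F c\<close> that
      spans it.\<close>
    have "\<forall>c. \<exists>F. finite F \<and> F \<subseteq> range monomial_fun \<and> q c \<in> fun_space.span F"
    proof
      fix c
      have "q c \<in> fun_space.span (range monomial_fun)"
        using q(1) poly_fun_subset_span_monomial_fun by blast
      then obtain F r where F: "finite F" "F \<subseteq> range monomial_fun" "q c = (\<Sum>a\<in>F. (\<lambda>x. r a * a x))"
        unfolding fun_space.span_explicit by blast
      have "q c \<in> fun_space.span F"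
        unfolding F(3) by (intro fun_space.span_sum fun_space.span_scale fun_space.span_base)
      then show "\<exists>F. finite F \<and> F \<subseteq> range monomial_fun \<and> q c \<in> fun_space.span F" using F by blast
    qed
    then obtain F where F: "\<And>c. finite (F c)" "\<And>c. F c \<subseteq> range monomial_fun"
      "\<And>c. q c \<in> fun_space.span (F c)" by metis
    have "countable (UNIV \<times> {F::'n rfun set. finite F \<and> F \<subseteq> range monomial_fun} :: (nat \<times> 'n rfun set) set)"
      by (intro countable_SIGMA countable_Collect_finite_subset) auto
    then have "countable (range (\<lambda>c. (n c, F c)))"
      by (rule countable_subset[rotated]) (use F in auto)
    then obtain y where "infinite {c. (n c, F c) = y}" using exists_infinite_fiber by blast
    then obtain N E where inf: "infinite {c. n c = N \<and> F c = E}" by (cases y) auto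
    define C where "C = {c. n c = N \<and> F c = E}"
    have fN: "f ^ N \<in> poly_fun" "f ^ N \<notin> P" using f R_simps P(3) by auto
    have qC: "f ^ N - q c * (\<lambda>x. x $ i - c) \<in> P" if "c \<in> C" for c
      using q(2)[of c] that by (simp add: C_def)
    \<comment> \<open>A dependence needs infinitely many distinct \<open>q c\<close>. If
      \<open>q c = q d\<close>, the two congruences differ by \<open>(d - c) q c\<close>, so
      \<open>q c\<close> and with it \<open>f ^ N\<close> would lie in \<open>P\<close>.\<close>
    have inj: "inj_on q C"
    proof (rule inj_onI, rule ccontr)
      fix c d assume cd: "c \<in> C" "d \<in> C" "q c = q d" "c \<noteq> d"
      let ?l = "\<lambda>c x. x $ i - c"
      have "(?l c * (\<lambda>x. 1 / (d - c))) * ((f ^ N - q c * ?l d) - (f ^ N - q c * ?l c)) + (f ^ N - q c * ?l c) \<in> P"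
        using qC[OF cd(1)] qC[OF cd(2)] cd(3) q(1)
        by (intro P_simps(3) P_simps(4)[OF _ P_simps(7)] R_simps(4) poly_fun_coord_diff pconst) auto
      also have "(?l c * (\<lambda>x. 1 / (d - c))) * ((f ^ N - q c * ?l d) - (f ^ N - q c * ?l c)) + (f ^ N - q c * ?l c) = f ^ N"
        using cd(4) by (auto simp: fun_eq_iff divide_simps) (simp add: algebra_simps)
      finally show False using fN(2) by blast
    qed
    have "fun_space.dependent (q ` C)"
    proof (rule ccontr)
      assume "\<not> ?thesis"
      moreover have "finite E" using F(1) inf by (metis (mono_tags, lifting) Collect_empty_eq finite.emptyI)
      moreover have "q ` C \<subseteq> fun_space.span E" using F(3) by (auto simp: C_def)
      ultimately have "finite (q ` C)" using fun_space.independent_span_bound by blast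
      then show False using inj inf by (simp add: finite_image_iff C_def)
    qed
    then obtain T0 u0 where T0: "finite T0" "T0 \<subseteq> q ` C" "(\<Sum>v\<in>T0. (\<lambda>x. u0 v * v x)) = 0" "\<exists>v\<in>T0. u0 v \<noteq> 0"
      unfolding fun_space.dependent_explicit by blast
    obtain T where T: "T \<subseteq> C" "finite T" "T0 = q ` T"
      using finite_subset_image[OF T0(1,2)] by auto
    define u where "u c = u0 (q c)" for c
    have injT: "inj_on q T" using inj T(1) inj_on_subset by blast
    have dep: "(\<Sum>c\<in>T. u c * q c x) = 0" for x
      using fun_cong[OF T0(3), of x] by (simp add: T(3) sum.reindex[OF injT] sum_fun_apply u_def)
    obtain d where d: "d \<in> T" "u d \<noteq> 0" using T0(4) T(3) by (auto simp: u_def)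
    \<comment> \<open>Multiply the congruence for \<open>c\<close> by \<open>u c\<close> and by all
      other factors \<open>x_i - k\<close>, then sum: the terms with \<open>q c\<close> become the
      full product times the vanishing sum of the \<open>u c q c\<close>, and
      \<open>p(x_i) f ^ N\<close> remains. At \<open>d\<close> only one summand of \<open>p\<close>
      survives, so \<open>p\<close> is nonzero.\<close>
    define p where "p = (\<Sum>c\<in>T. smult (u c) (\<Prod>k\<in>T - {c}. [:- k, 1:]))"
    have "poly p d = (\<Sum>c\<in>T. u c * (\<Prod>k\<in>T - {c}. d - k))"
      by (simp add: p_def poly_sum poly_prod)
    also have "\<dots> = u d * (\<Prod>k\<in>T - {d}. d - k)"
      using T(2) d(1) by (subst sum.remove[OF T(2) d(1)]) (auto intro!: sum.neutral)
    also have "\<dots> \<noteq> 0" using T(2) d by simp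
    finally have "p \<noteq> 0" by auto
    have "(\<Sum>c\<in>T. (\<lambda>x. u c * (\<Prod>k\<in>T - {c}. x $ i - k)) * (f ^ N - q c * (\<lambda>x. x $ i - c))) \<in> P"
      using T(1) by (intro ideal_of_sum[OF P(1)] P_simps(4) qC pmult pconst poly_fun_prod poly_fun_coord_diff) auto
    moreover have "(\<Sum>c\<in>T. (\<lambda>x. u c * (\<Prod>k\<in>T - {c}. x $ i - k)) * (f ^ N - q c * (\<lambda>x. x $ i - c)))
      = (\<lambda>x. poly p (x $ i)) * f ^ N"
    proof
      fix x
      have "(\<Sum>c\<in>T. u c * (\<Prod>k\<in>T - {c}. x $ i - k) * ((f ^ N) x - q c x * (x $ i - c))) =
        (\<Sum>c\<in>T. u c * (\<Prod>k\<in>T - {c}. x $ i - k) * (f ^ N) x - (\<Prod>k\<in>T. x $ i - k) * (u c * q c x))"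
        using T(2) by (intro sum.cong) (auto simp: algebra_simps prod.remove)
      also have "\<dots> = (\<Sum>c\<in>T. u c * (\<Prod>k\<in>T - {c}. x $ i - k)) * (f ^ N) x"
        by (simp add: sum_subtractf sum_distrib_right flip: sum_distrib_left) (simp add: dep)
      also have "\<dots> = poly p (x $ i) * (f ^ N) x"
        by (simp add: p_def poly_sum poly_prod)
      finally show "(\<Sum>c\<in>T. (\<lambda>x. u c * (\<Prod>k\<in>T - {c}. x $ i - k)) * (f ^ N - q c * (\<lambda>x. x $ i - c))) x
        = ((\<lambda>x. poly p (x $ i)) * f ^ N) x"
        by (simp add: sum_fun_apply)
    qed
    ultimately show False
      using prime_contains_linear_factor[OF P(1) prime fN \<open>p \<noteq> 0\<close>, of i] none by metis
  qed
  then obtain c where c: "\<And>i. (\<lambda>x. x $ i - c i) \<in> P" by metis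
  define z :: "complex^'n" where "z = (\<chi> i. c i)"
  \<comment> \<open>As all \<open>x_i - z_i\<close> lie in \<open>P\<close>, each polynomial equals
    its value at \<open>z\<close> modulo \<open>P\<close>. A \<open>g\<close> in \<open>J\<close>
    with \<open>g z \<noteq> 0\<close> would then put 1 into \<open>P\<close>.\<close>
  have ev: "(\<lambda>x. g x - g z) \<in> P" if "g \<in> poly_fun" for g
    using that
  proof induction
    case (pconst c)
    then show ?case using P_simps(1) by (simp add: zero_fun_def)
  next
    case (pcoord i)
    then show ?case using c by (simp add: z_def)
  next
    case (padd p q)
    then have "(\<lambda>x. p x - p z) + (\<lambda>x. q x - q z) \<in> P" using P_simps by blast
    then show ?case by (simp add: plus_fun_def algebra_simps)
  next
    case (pmult p q)
    then have "q * (\<lambda>x. p x - p z) + (\<lambda>x. p z) * (\<lambda>x. q x - q z) \<in> P"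
      by (intro P_simps(3,4) poly_fun.pconst)
    then show ?case by (simp add: plus_fun_def times_fun_def algebra_simps)
  qed
  have "g z = 0" if "g \<in> J" for g
  proof (rule ccontr)
    assume "g z \<noteq> 0"
    have g: "g \<in> P" "g \<in> poly_fun" using that P(2) P_simps by auto
    have "(\<lambda>x. 1 / g z) * (g - (\<lambda>x. g x - g z)) \<in> P"
      using g ev by (intro P_simps(4,7) pconst)
    also have "(\<lambda>x. 1 / g z) * (g - (\<lambda>x. g x - g z)) = f ^ 0"
      using \<open>g z \<noteq> 0\<close> by (auto simp: fun_eq_iff)
    finally show False using P(3) by blast
  qed
  then have "f z = 0" using van by blast
  then have "f ^ 1 \<in> P" using ev[OF f] by simp
  then show False using P(3) by blast
qed

section \<open>Derivations and automorphisms\<close>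

text \<open>Regular functions are extended by zero off \<open>X\<close>; this map sends the
  polynomials onto the coordinate ring, whose unit is
  \<open>restr X (\<lambda>x. 1)\<close>.\<close>

definition restr :: "'a set \<Rightarrow> ('a \<Rightarrow> complex) \<Rightarrow> 'a \<Rightarrow> complex" where
  "restr X p = (\<lambda>x. if x \<in> X then p x else 0)"

lemma coord_ring_eq_restr: "coord_ring X = restr X ` poly_fun"
  by (auto simp: coord_ring_def restr_def fun_eq_iff)

lemma coord_ring_outside: "f \<in> coord_ring X \<Longrightarrow> x \<notin> X \<Longrightarrow> f x = 0"
  by (auto simp: coord_ring_def)

lemma coord_ring_add: "f \<in> coord_ring X \<Longrightarrow> g \<in> coord_ring X \<Longrightarrow> (\<lambda>x. f x + g x) \<in> coord_ring X"
proof -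
  assume "f \<in> coord_ring X" "g \<in> coord_ring X"
  then obtain p q where "p \<in> poly_fun" "q \<in> poly_fun" "f = restr X p" "g = restr X q"
    by (auto simp: coord_ring_eq_restr)
  then show ?thesis unfolding coord_ring_def
    by (intro CollectI bexI[OF _ padd[of p q]]) (auto simp: restr_def)
qed

lemma coord_ring_mult: "f \<in> coord_ring X \<Longrightarrow> g \<in> coord_ring X \<Longrightarrow> (\<lambda>x. f x * g x) \<in> coord_ring X"
proof -
  assume "f \<in> coord_ring X" "g \<in> coord_ring X"
  then obtain p q where "p \<in> poly_fun" "q \<in> poly_fun" "f = restr X p" "g = restr X q"
    by (auto simp: coord_ring_eq_restr)
  then show ?thesis unfolding coord_ring_def
    by (intro CollectI bexI[OF _ pmult[of p q]]) (auto simp: restr_def)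
qed

lemma coord_ring_const: "restr X (\<lambda>x. c) \<in> coord_ring X"
  unfolding coord_ring_eq_restr using pconst by blast

lemma coord_ring_zero: "(\<lambda>x. 0) \<in> coord_ring X"
  using coord_ring_const[of X 0] by (simp add: restr_def)

lemma coord_ring_cmult: "f \<in> coord_ring X \<Longrightarrow> (\<lambda>x. c * f x) \<in> coord_ring X"
proof -
  assume f: "f \<in> coord_ring X"
  have "(\<lambda>x. restr X (\<lambda>x. c) x * f x) = (\<lambda>x. c * f x)"
    using coord_ring_outside[OF f] by (auto simp: restr_def fun_eq_iff)
  then show ?thesis using coord_ring_mult[OF coord_ring_const f, of c] by simp
qed

lemma coord_ring_uminus: "f \<in> coord_ring X \<Longrightarrow> (\<lambda>x. - f x) \<in> coord_ring X"
  using coord_ring_cmult[of f X "- 1"] by simp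

lemma coord_ring_diff: "f \<in> coord_ring X \<Longrightarrow> g \<in> coord_ring X \<Longrightarrow> (\<lambda>x. f x - g x) \<in> coord_ring X"
  using coord_ring_add[OF _ coord_ring_uminus, of f X g] by simp

lemma coord_fun_in_coord_ring: "coord_fun X i \<in> coord_ring X"
  unfolding coord_fun_def coord_ring_def by (auto intro!: bexI[OF _ pcoord[of i]])

lemmas coord_ring_intros = coord_ring_zero coord_ring_add coord_ring_mult coord_ring_cmult
  coord_ring_uminus coord_ring_diff

lemma coord_ring_induct [consumes 1, case_names const coord add mult]:
  assumes "f \<in> coord_ring X"
    and "\<And>c. P (restr X (\<lambda>x. c))" and "\<And>i. P (coord_fun X i)"
    and add: "\<And>f g. f \<in> coord_ring X \<Longrightarrow> g \<in> coord_ring X \<Longrightarrow> P f \<Longrightarrow> P g \<Longrightarrow> P (\<lambda>x. f x + g x)"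
    and mult: "\<And>f g. f \<in> coord_ring X \<Longrightarrow> g \<in> coord_ring X \<Longrightarrow> P f \<Longrightarrow> P g \<Longrightarrow> P (\<lambda>x. f x * g x)"
  shows "P f"
proof -
  obtain p where "p \<in> poly_fun" and f: "f = restr X p"
    using assms(1) by (auto simp: coord_ring_eq_restr)
  then show ?thesis unfolding f
  proof (induction p)
    case (pcoord i)
    then show ?case using assms(3)[of i] by (simp add: restr_def coord_fun_def)
  next
    case (padd p q)
    have "(\<lambda>x. restr X p x + restr X q x) = restr X (\<lambda>x. p x + q x)"
      by (auto simp: restr_def)
    then show ?case using add[of "restr X p" "restr X q"] padd by (simp add: coord_ring_eq_restr)
  next
    case (pmult p q)
    have "(\<lambda>x. restr X p x * restr X q x) = restr X (\<lambda>x. p x * q x)"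
      by (auto simp: restr_def)
    then show ?case using mult[of "restr X p" "restr X q"] pmult by (simp add: coord_ring_eq_restr)
  qed (rule assms(2))
qed

lemma is_derivationD:
  assumes "is_derivation X D"
  shows "f \<in> coord_ring X \<Longrightarrow> D f \<in> coord_ring X"
    and "f \<notin> coord_ring X \<Longrightarrow> D f = (\<lambda>x. 0)"
    and "f \<in> coord_ring X \<Longrightarrow> g \<in> coord_ring X \<Longrightarrow> D (\<lambda>x. f x + g x) = (\<lambda>x. D f x + D g x)"
    and "f \<in> coord_ring X \<Longrightarrow> D (\<lambda>x. c * f x) = (\<lambda>x. c * D f x)"
    and "f \<in> coord_ring X \<Longrightarrow> g \<in> coord_ring X \<Longrightarrow> D (\<lambda>x. f x * g x) = (\<lambda>x. f x * D g x + g x * D f x)"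
    and "D (\<lambda>x. 0) = (\<lambda>x. 0)"
proof -
  show c: "D (\<lambda>x. c * f x) = (\<lambda>x. c * D f x)" if "f \<in> coord_ring X" for f c
    using assms that unfolding is_derivation_def by blast
  show "D (\<lambda>x. 0) = (\<lambda>x. 0)" using c[OF coord_ring_zero, of 0] by simp
qed (use assms in \<open>unfold is_derivation_def, blast+\<close>)

lemma VF_alg_derivation: "D \<in> VF_alg X Y \<Longrightarrow> is_derivation X D"
  by (simp add: VF_alg_def)

lemma VF_alg_vanish:
  assumes "D \<in> VF_alg X Y" "y \<in> Y" shows "D f y = 0"
proof (cases "f \<in> coord_ring X")
  case True
  then show ?thesis using assms by (auto simp: VF_alg_def vanishing_ideal_def)
next
  case False
  then show ?thesis using is_derivationD(2)[OF VF_alg_derivation[OF assms(1)]] by simp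
qed

lemma VF_algI:
  assumes "is_derivation X D" "\<And>f y. y \<in> Y \<Longrightarrow> D f y = 0" shows "D \<in> VF_alg X Y"
  using assms is_derivationD(1)[OF assms(1)] by (auto simp: VF_alg_def vanishing_ideal_def)

lemma VF_alg_zero: "(\<lambda>f x. 0) \<in> VF_alg X Y"
  by (rule VF_algI) (auto simp: is_derivation_def coord_ring_zero)

lemma VF_alg_add:
  assumes "D \<in> VF_alg X Y" "E \<in> VF_alg X Y" shows "vf_add D E \<in> VF_alg X Y"
proof (rule VF_algI)
  note D = is_derivationD[OF VF_alg_derivation[OF assms(1)]] and E = is_derivationD[OF VF_alg_derivation[OF assms(2)]]
  show "is_derivation X (vf_add D E)"
    unfolding is_derivation_def vf_add_def
    by (simp add: D E coord_ring_intros fun_eq_iff algebra_simps)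
  show "vf_add D E f y = 0" if "y \<in> Y" for f y
    using VF_alg_vanish[OF assms(1) that] VF_alg_vanish[OF assms(2) that] by (simp add: vf_add_def)
qed

lemma VF_alg_smult:
  assumes "D \<in> VF_alg X Y" "g \<in> coord_ring X" shows "mod_smult g D \<in> VF_alg X Y"
proof (rule VF_algI)
  note D = is_derivationD[OF VF_alg_derivation[OF assms(1)]]
  show "is_derivation X (mod_smult g D)"
    unfolding is_derivation_def mod_smult_def
    by (simp add: D assms(2) coord_ring_intros fun_eq_iff algebra_simps)
  show "mod_smult g D f y = 0" if "y \<in> Y" for f y
    using VF_alg_vanish[OF assms(1) that] by (simp add: mod_smult_def)
qed

lemma derivation_outside: "is_derivation X D \<Longrightarrow> x \<notin> X \<Longrightarrow> D f x = 0"
  using is_derivationD(1,2)[of X D f] coord_ring_outside by metis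

lemma VF_alg_cscale:
  assumes "D \<in> VF_alg X Y" shows "(\<lambda>f x. c * D f x) \<in> VF_alg X Y"
proof -
  have "(\<lambda>f x. c * D f x) = mod_smult (restr X (\<lambda>x. c)) D"
    using derivation_outside[OF VF_alg_derivation[OF assms]]
    by (intro ext) (simp add: mod_smult_def restr_def)
  then show ?thesis using VF_alg_smult[OF assms coord_ring_const] by simp
qed

lemma VF_alg_bracket:
  assumes "D \<in> VF_alg X Y" "E \<in> VF_alg X Y" shows "vf_bracket D E \<in> VF_alg X Y"
proof (rule VF_algI)
  note D = is_derivationD[OF VF_alg_derivation[OF assms(1)]] and E = is_derivationD[OF VF_alg_derivation[OF assms(2)]]
  show "is_derivation X (vf_bracket D E)"
    unfolding is_derivation_def vf_bracket_def
    by (simp add: D E coord_ring_intros fun_eq_iff algebra_simps)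
  show "vf_bracket D E f y = 0" if "y \<in> Y" for f y
    using VF_alg_vanish[OF assms(1) that] VF_alg_vanish[OF assms(2) that] by (simp add: vf_bracket_def)
qed

lemma Lie_alg_subset_VF_alg: "Lie_alg X Y \<subseteq> VF_alg X Y"
proof
  fix D assume "D \<in> Lie_alg X Y"
  then show "D \<in> VF_alg X Y"
    by induction (auto intro: VF_alg_zero VF_alg_add VF_alg_cscale VF_alg_bracket)
qed

text \<open>Completeness prescribes the differential equation for the coordinates alone. These and
  the constants generate the ring, so the sum and product rules extend it to every regular
  function.\<close>

lemma derivative_along_flow:
  assumes "is_derivation X D" and mem: "\<And>t. \<gamma> t \<in> X"
    and flow: "\<And>t i. ((\<lambda>s. \<gamma> s $ i) has_field_derivative D (coord_fun X i) (\<gamma> t)) (at t)"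
    and "f \<in> coord_ring X"
  shows "((\<lambda>s. f (\<gamma> s)) has_field_derivative D f (\<gamma> t)) (at t)"
  using assms(4)
proof (induction rule: coord_ring_induct)
  note D = is_derivationD[OF assms(1)]
  {
    case (const c)
    let ?u = "restr X (\<lambda>x. 1)"
    have u: "?u \<in> coord_ring X" by (rule coord_ring_const)
    \<comment> \<open>The unit is idempotent, so \<open>D ?u\<close> is twice
      \<open>?u * D ?u\<close> and vanishes where \<open>?u\<close> is 1: derivations kill
      constants.\<close>
    have "D (\<lambda>x. ?u x * ?u x) = D ?u" by (rule arg_cong[of _ _ D]) (auto simp: restr_def)
    then have "D ?u (\<gamma> t) = ?u (\<gamma> t) * D ?u (\<gamma> t) + ?u (\<gamma> t) * D ?u (\<gamma> t)"
      unfolding D(5)[OF u u] by (rule fun_cong[OF sym])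
    then have "D ?u (\<gamma> t) = 0" using mem by (simp add: restr_def)
    moreover have "restr X (\<lambda>x. c) = (\<lambda>x. c * ?u x)" by (auto simp: restr_def)
    ultimately have "D (restr X (\<lambda>x. c)) (\<gamma> t) = 0" using D(4)[OF u, of c] by simp
    then show ?case using mem by (simp add: restr_def)
  next
    case (coord i)
    then show ?case using flow mem by (simp add: coord_fun_def)
  next
    case (add f g)
    then show ?case using D(3) by (auto intro!: derivative_eq_intros)
  next
    case (mult f g)
    then show ?case using D(5) by (auto intro!: derivative_eq_intros simp: algebra_simps)
  }
qed

section \<open>Pullbacks and transport of vector fields along automorphisms\<close>

lemma poly_fun_comp_poly_map:
  assumes "poly_map X \<phi>" "p \<in> poly_fun" shows "\<exists>q\<in>poly_fun. \<forall>x\<in>X. p (\<phi> x) = q x"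
  using assms(2)
proof induction
  case (pconst c)
  show ?case by (rule bexI[OF _ poly_fun.pconst[of c]]) simp
next
  case (pcoord i)
  then show ?case using assms(1) by (auto simp: poly_map_def)
next
  case (padd p q)
  then obtain p' q' where "p' \<in> poly_fun" "q' \<in> poly_fun" "\<forall>x\<in>X. p (\<phi> x) = p' x" "\<forall>x\<in>X. q (\<phi> x) = q' x" by blast
  then show ?case by (intro bexI[OF _ poly_fun.padd[of p' q']]) auto
next
  case (pmult p q)
  then obtain p' q' where "p' \<in> poly_fun" "q' \<in> poly_fun" "\<forall>x\<in>X. p (\<phi> x) = p' x" "\<forall>x\<in>X. q (\<phi> x) = q' x" by blast
  then show ?case by (intro bexI[OF _ poly_fun.pmult[of p' q']]) auto
qed

lemma pullback_in_coord_ring: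
  assumes "poly_map X \<phi>" "f \<in> coord_ring X" shows "pullback X \<phi> f \<in> coord_ring X"
proof -
  obtain p where p: "p \<in> poly_fun" "f = restr X p" using assms(2) by (auto simp: coord_ring_eq_restr)
  obtain q where q: "q \<in> poly_fun" "\<forall>x\<in>X. p (\<phi> x) = q x"
    using poly_fun_comp_poly_map[OF assms(1) p(1)] by blast
  have "pullback X \<phi> f = restr X q"
    using q p assms(1) by (auto simp: pullback_def restr_def poly_map_def fun_eq_iff)
  then show ?thesis using q by (simp add: coord_ring_eq_restr)
qed

lemma pullback_arith:
  "pullback X \<phi> (\<lambda>x. f x + g x) = (\<lambda>x. pullback X \<phi> f x + pullback X \<phi> g x)"
  "pullback X \<phi> (\<lambda>x. f x - g x) = (\<lambda>x. pullback X \<phi> f x - pullback X \<phi> g x)"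
  "pullback X \<phi> (\<lambda>x. c * f x) = (\<lambda>x. c * pullback X \<phi> f x)"
  "pullback X \<phi> (\<lambda>x. 0) = (\<lambda>x. 0)"
  by (auto simp: pullback_def)

lemma pullback_mult: "pullback X \<phi> (\<lambda>x. f x * g x) = (\<lambda>x. pullback X \<phi> f x * pullback X \<phi> g x)"
  by (auto simp: pullback_def)

text \<open>Naming the inverse and asking it to stabilise \<open>Y\<close> makes the notion
  symmetric, so that every fact about \<open>\<phi>\<close> is also one about
  \<open>\<psi>\<close>.\<close>

definition aut_pair :: "(complex^'n::finite) set \<Rightarrow> (complex^'n) set \<Rightarrow>
    (complex^'n \<Rightarrow> complex^'n) \<Rightarrow> (complex^'n \<Rightarrow> complex^'n) \<Rightarrow> bool" where
  "aut_pair X Y \<phi> \<psi> \<longleftrightarrow> poly_map X \<phi> \<and> poly_map X \<psi> \<and> (\<forall>x\<in>X. \<psi> (\<phi> x) = x \<and> \<phi> (\<psi> x) = x)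
     \<and> \<phi> ` Y = Y \<and> \<psi> ` Y = Y"

lemma aut_pair_sym: "aut_pair X Y \<phi> \<psi> \<Longrightarrow> aut_pair X Y \<psi> \<phi>"
  by (auto simp: aut_pair_def)

lemma Aut_rel_aut_pair:
  assumes "\<phi> \<in> Aut_rel X Y" "Y \<subseteq> X" obtains \<psi> where "aut_pair X Y \<phi> \<psi>"
proof -
  obtain \<psi> where \<psi>: "poly_map X \<phi>" "\<phi> ` Y = Y" "poly_map X \<psi>" "\<forall>x\<in>X. \<psi> (\<phi> x) = x \<and> \<phi> (\<psi> x) = x"
    using assms(1) unfolding Aut_rel_def by blast
  have "\<psi> ` Y = \<psi> ` \<phi> ` Y" using \<psi>(2) by simp
  also have "\<dots> = Y" using \<psi>(4) assms(2) by (force simp: image_image subset_iff)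
  finally show ?thesis using \<psi> that by (auto simp: aut_pair_def)
qed

lemma aut_pair_mem: "aut_pair X Y \<phi> \<psi> \<Longrightarrow> x \<in> X \<Longrightarrow> \<phi> x \<in> X"
  by (auto simp: aut_pair_def poly_map_def)

lemma aut_pair_inv: "aut_pair X Y \<phi> \<psi> \<Longrightarrow> x \<in> X \<Longrightarrow> \<psi> (\<phi> x) = x"
  by (auto simp: aut_pair_def)

lemma aut_pair_pullback: "aut_pair X Y \<phi> \<psi> \<Longrightarrow> f \<in> coord_ring X \<Longrightarrow> pullback X \<phi> f \<in> coord_ring X"
  by (auto simp: aut_pair_def intro: pullback_in_coord_ring)

lemma pullback_pullback_inv:
  assumes "aut_pair X Y \<phi> \<psi>" "f \<in> coord_ring X"
  shows "pullback X \<phi> (pullback X \<psi> f) = f"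
  using coord_ring_outside[OF assms(2)] aut_pair_mem[OF assms(1)] aut_pair_inv[OF assms(1)]
  by (auto simp: pullback_def fun_eq_iff)

text \<open>The vector field moved by \<open>\<phi>\<close>, as conjugation of the derivation by the
  two pullbacks. The value 0 off the coordinate ring is the default that
  \<open>is_derivation\<close> demands.\<close>

definition pushforward :: "(complex^'n::finite) set \<Rightarrow> (complex^'n \<Rightarrow> complex^'n) \<Rightarrow>
    (complex^'n \<Rightarrow> complex^'n) \<Rightarrow> ('n rfun \<Rightarrow> 'n rfun) \<Rightarrow> ('n rfun \<Rightarrow> 'n rfun)" where
  "pushforward X \<phi> \<psi> D = (\<lambda>f. if f \<in> coord_ring X then pullback X \<psi> (D (pullback X \<phi> f)) else (\<lambda>x. 0))"

context
  fixes X Y :: "(complex^'n::finite) set" and \<phi> \<psi>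
  assumes aut: "aut_pair X Y \<phi> \<psi>"
begin

lemmas aut_pullbacks = aut_pair_pullback[OF aut] aut_pair_pullback[OF aut_pair_sym[OF aut]]
  pullback_pullback_inv[OF aut] pullback_pullback_inv[OF aut_pair_sym[OF aut]]

lemma pushforward_VF_alg:
  assumes "D \<in> VF_alg X Y" shows "pushforward X \<phi> \<psi> D \<in> VF_alg X Y"
proof (rule VF_algI)
  note D = is_derivationD[OF VF_alg_derivation[OF assms]]
  show "is_derivation X (pushforward X \<phi> \<psi> D)"
    unfolding is_derivation_def
  proof (intro conjI ballI)
    fix f g assume "f \<in> coord_ring X" "g \<in> coord_ring X"
    then show "pushforward X \<phi> \<psi> D (\<lambda>x. f x * g x) =
      (\<lambda>x. f x * pushforward X \<phi> \<psi> D g x + g x * pushforward X \<phi> \<psi> D f x)"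
      by (simp add: pushforward_def D coord_ring_intros aut_pullbacks pullback_arith(1) pullback_mult)
  qed (simp_all add: pushforward_def D coord_ring_intros aut_pullbacks pullback_arith)
  show "pushforward X \<phi> \<psi> D f y = 0" if "y \<in> Y" for f y
  proof -
    have "\<psi> y \<in> Y" using that aut by (auto simp: aut_pair_def)
    then show ?thesis
      using VF_alg_vanish[OF assms] by (simp add: pushforward_def pullback_def)
  qed
qed

text \<open>\<open>\<phi>\<close> maps integral curves of \<open>D\<close> to those of the
  pushforward. The coordinates of the image curve are pullbacks of coordinate functions, whose
  derivatives come from \<open>derivative_along_flow\<close>.\<close>

lemma pushforward_complete:
  assumes "D \<in> VF_alg X Y" "complete_field X D" shows "complete_field X (pushforward X \<phi> \<psi> D)"
  unfolding complete_field_def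
proof
  fix x assume x: "x \<in> X"
  then have "\<psi> x \<in> X" using aut_pair_mem[OF aut_pair_sym[OF aut]] by blast
  then obtain \<gamma> where \<gamma>: "\<gamma> 0 = \<psi> x" "\<And>t. \<gamma> t \<in> X"
    "\<And>t i. ((\<lambda>s. \<gamma> s $ i) has_field_derivative D (coord_fun X i) (\<gamma> t)) (at t)"
    using assms(2) unfolding complete_field_def by metis
  show "\<exists>\<gamma>. \<gamma> 0 = x \<and> (\<forall>t. \<gamma> t \<in> X) \<and> (\<forall>t i. ((\<lambda>s. \<gamma> s $ i) has_field_derivative
      pushforward X \<phi> \<psi> D (coord_fun X i) (\<gamma> t)) (at t))"
  proof (intro exI[of _ "\<lambda>t. \<phi> (\<gamma> t)"] conjI allI)
    show "\<phi> (\<gamma> 0) = x" using aut_pair_inv[OF aut_pair_sym[OF aut] x] \<gamma>(1) by simp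
    show mem: "\<phi> (\<gamma> t) \<in> X" for t using aut_pair_mem[OF aut] \<gamma>(2) by blast
    fix t i
    have cf: "coord_fun X i \<in> coord_ring X" by (rule coord_fun_in_coord_ring)
    have "((\<lambda>s. pullback X \<phi> (coord_fun X i) (\<gamma> s)) has_field_derivative
        D (pullback X \<phi> (coord_fun X i)) (\<gamma> t)) (at t)"
      by (rule derivative_along_flow[OF VF_alg_derivation[OF assms(1)] \<gamma>(2,3) aut_pullbacks(1)[OF cf]])
    moreover have "pullback X \<phi> (coord_fun X i) (\<gamma> s) = \<phi> (\<gamma> s) $ i" for s
      using \<gamma>(2) mem by (simp add: pullback_def coord_fun_def)
    moreover have "pushforward X \<phi> \<psi> D (coord_fun X i) (\<phi> (\<gamma> t)) = D (pullback X \<phi> (coord_fun X i)) (\<gamma> t)"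
      using mem aut_pair_inv[OF aut \<gamma>(2)] cf by (simp add: pushforward_def) (simp add: pullback_def)
    ultimately show "((\<lambda>s. \<phi> (\<gamma> s) $ i) has_field_derivative
        pushforward X \<phi> \<psi> D (coord_fun X i) (\<phi> (\<gamma> t))) (at t)" by simp
  qed
qed

lemma pushforward_Lie_alg: "D \<in> Lie_alg X Y \<Longrightarrow> pushforward X \<phi> \<psi> D \<in> Lie_alg X Y"
proof (induction rule: Lie_alg.induct)
  case (lgen D)
  then show ?case using Lie_alg.lgen pushforward_VF_alg pushforward_complete by blast
next
  case lzero
  have "pushforward X \<phi> \<psi> (\<lambda>f x. 0) = (\<lambda>f x. 0)"
    by (auto simp: pushforward_def pullback_arith)
  then show ?case using Lie_alg.lzero by metis
next
  case (ladd D E)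
  have "pushforward X \<phi> \<psi> (vf_add D E) = vf_add (pushforward X \<phi> \<psi> D) (pushforward X \<phi> \<psi> E)"
    by (auto simp: pushforward_def pullback_arith vf_add_def)
  then show ?case using ladd Lie_alg.ladd by metis
next
  case (lscale D c)
  have "pushforward X \<phi> \<psi> (\<lambda>f x. c * D f x) = (\<lambda>f x. c * pushforward X \<phi> \<psi> D f x)"
    by (auto simp: pushforward_def pullback_arith fun_eq_iff)
  then show ?case using lscale Lie_alg.lscale by metis
next
  case (lbracket D E)
  then have "D \<in> VF_alg X Y" "E \<in> VF_alg X Y" using Lie_alg_subset_VF_alg by blast+
  note D = is_derivationD[OF VF_alg_derivation[OF this(1)]] and E = is_derivationD[OF VF_alg_derivation[OF this(2)]]
  have "pushforward X \<phi> \<psi> (vf_bracket D E) = vf_bracket (pushforward X \<phi> \<psi> D) (pushforward X \<phi> \<psi> E)"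
    by (rule ext) (simp add: pushforward_def pullback_arith vf_bracket_def D E aut_pullbacks coord_ring_zero)
  then show ?case using lbracket Lie_alg.lbracket by metis
qed

text \<open>Through this formula the invariance of the Lie algebra passes to \<open>lie_core\<close>
  and to \<open>lie_conductor\<close>.\<close>

lemma mod_smult_pushforward:
  assumes "g \<in> coord_ring X"
  shows "mod_smult g (pushforward X \<phi> \<psi> D) = pushforward X \<phi> \<psi> (mod_smult (pullback X \<phi> g) D)"
  by (intro ext) (simp add: mod_smult_def pushforward_def pullback_mult aut_pullbacks assms)

lemma pushforward_inverse:
  assumes "D \<in> VF_alg X Y" shows "pushforward X \<phi> \<psi> (pushforward X \<psi> \<phi> D) = D"
proof -
  note D = is_derivationD[OF VF_alg_derivation[OF assms]]
  show ?thesis by (rule ext) (simp add: pushforward_def D aut_pullbacks)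
qed

end

section \<open>Dual systems of vector fields\<close>

text \<open>The module \<open>W\<close> of the overview; demanding all multiples makes it closed
  under multiplication by functions.\<close>

definition lie_core :: "(complex^'n::finite) set \<Rightarrow> (complex^'n) set \<Rightarrow> ('n rfun \<Rightarrow> 'n rfun) set" where
  "lie_core X Y = {D \<in> VF_alg X Y. \<forall>g\<in>coord_ring X. mod_smult g D \<in> Lie_alg X Y}"

text \<open>\<open>ADP_rel\<close> amounts to some power of the ideal of \<open>Y\<close> lying in
  this ideal quotient.\<close>

definition lie_conductor :: "(complex^'n::finite) set \<Rightarrow> (complex^'n) set \<Rightarrow> 'n rfun set" where
  "lie_conductor X Y = {g \<in> coord_ring X. \<forall>D\<in>VF_alg X Y. mod_smult g D \<in> Lie_alg X Y}"

lemma mod_smult_simps: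
  "mod_smult g (vf_add D E) = vf_add (mod_smult g D) (mod_smult g E)"
  "mod_smult g (mod_smult h D) = mod_smult (\<lambda>x. g x * h x) D"
  "mod_smult (\<lambda>x. g x + h x) D = vf_add (mod_smult g D) (mod_smult h D)"
  by (auto simp: mod_smult_def vf_add_def algebra_simps)

lemma lie_core_VF_alg: "D \<in> lie_core X Y \<Longrightarrow> D \<in> VF_alg X Y"
  by (simp add: lie_core_def)

lemma lie_core_add: "D \<in> lie_core X Y \<Longrightarrow> E \<in> lie_core X Y \<Longrightarrow> vf_add D E \<in> lie_core X Y"
  by (auto simp: lie_core_def mod_smult_simps intro: VF_alg_add Lie_alg.ladd)

lemma lie_core_smult: "D \<in> lie_core X Y \<Longrightarrow> g \<in> coord_ring X \<Longrightarrow> mod_smult g D \<in> lie_core X Y"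
  by (auto simp: lie_core_def mod_smult_simps intro: VF_alg_smult coord_ring_mult)

lemma lie_core_zero: "(\<lambda>f x. 0) \<in> lie_core X Y"
  using Lie_alg.lzero by (auto simp: lie_core_def VF_alg_zero mod_smult_def)

lemma lie_core_subset_Lie_alg: "lie_core X Y \<subseteq> Lie_alg X Y"
proof
  fix D assume D: "D \<in> lie_core X Y"
  then have "mod_smult (restr X (\<lambda>x. 1)) D \<in> Lie_alg X Y"
    using coord_ring_const by (auto simp: lie_core_def)
  moreover have "mod_smult (restr X (\<lambda>x. 1)) D = D"
    using derivation_outside[OF VF_alg_derivation[OF lie_core_VF_alg[OF D]]]
    by (intro ext) (simp add: mod_smult_def restr_def)
  ultimately show "D \<in> Lie_alg X Y" by simp
qed

lemma lie_core_sum: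
  assumes "finite B" "\<And>b. b \<in> B \<Longrightarrow> D b \<in> lie_core X Y" "\<And>b. b \<in> B \<Longrightarrow> g b \<in> coord_ring X"
  shows "(\<lambda>f x. \<Sum>b\<in>B. g b x * D b f x) \<in> lie_core X Y"
  using assms
proof (induction B rule: finite_induct)
  case empty
  then show ?case using lie_core_zero by simp
next
  case (insert b B)
  have "(\<lambda>f x. \<Sum>b\<in>insert b B. g b x * D b f x) =
      vf_add (mod_smult (g b) (D b)) (\<lambda>f x. \<Sum>b\<in>B. g b x * D b f x)"
    using insert.hyps by (simp add: vf_add_def mod_smult_def)
  then show ?case using insert by (auto intro!: lie_core_add lie_core_smult)
qed

lemma pushforward_lie_core:
  assumes "aut_pair X Y \<phi> \<psi>" "D \<in> lie_core X Y" shows "pushforward X \<phi> \<psi> D \<in> lie_core X Y"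
  using assms pushforward_VF_alg[OF assms(1)] pushforward_Lie_alg[OF assms(1)] aut_pair_pullback[OF assms(1)]
  by (auto simp: lie_core_def mod_smult_pushforward[OF assms(1)])

lemma fg_module_subset_lie_core:
  assumes "fg_module X L" "L \<subseteq> VF_alg X Y" "L \<subseteq> Lie_alg X Y" shows "L \<subseteq> lie_core X Y"
proof
  fix D assume D: "D \<in> L"
  obtain G where G: "L = {(\<lambda>f x. \<Sum>D\<in>G. c D x * D f x) | c. \<forall>D\<in>G. c D \<in> coord_ring X}"
    using assms(1) unfolding fg_module_def by blast
  then obtain c where c: "D = (\<lambda>f x. \<Sum>D\<in>G. c D x * D f x)" "\<forall>D\<in>G. c D \<in> coord_ring X"
    using D by blast
  have "mod_smult g D \<in> L" if "g \<in> coord_ring X" for g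
  proof -
    have "mod_smult g D = (\<lambda>f x. \<Sum>D\<in>G. (g x * c D x) * D f x)"
      by (simp add: c(1) mod_smult_def sum_distrib_left mult.assoc)
    then show ?thesis using c(2) that unfolding G
      by (intro CollectI exI[of _ "\<lambda>D x. g x * c D x"]) (auto intro: coord_ring_mult)
  qed
  then show "D \<in> lie_core X Y" using assms D by (auto simp: lie_core_def)
qed

text \<open>Every field is a pushforward, namely of its transport \<open>?E\<close> along the
  inverse; moving the coefficient inside leaves the pushforward of \<open>g\<close> times
  \<open>?E\<close>.\<close>

lemma pullback_lie_conductor:
  assumes aut: "aut_pair X Y \<phi> \<psi>" and g: "g \<in> lie_conductor X Y"
  shows "pullback X \<psi> g \<in> lie_conductor X Y"
proof -
  have gR: "g \<in> coord_ring X" using g by (simp add: lie_conductor_def)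
  have gR': "pullback X \<psi> g \<in> coord_ring X" using aut_pair_pullback[OF aut_pair_sym[OF aut] gR] .
  have "mod_smult (pullback X \<psi> g) D \<in> Lie_alg X Y" if D: "D \<in> VF_alg X Y" for D
  proof -
    let ?E = "pushforward X \<psi> \<phi> D"
    have "mod_smult (pullback X \<psi> g) D = mod_smult (pullback X \<psi> g) (pushforward X \<phi> \<psi> ?E)"
      using pushforward_inverse[OF aut D] by simp
    also have "\<dots> = pushforward X \<phi> \<psi> (mod_smult g ?E)"
      by (simp add: mod_smult_pushforward[OF aut gR'] pullback_pullback_inv[OF aut gR])
    also have "\<dots> \<in> Lie_alg X Y"
      using g pushforward_VF_alg[OF aut_pair_sym[OF aut] D]
      by (auto simp: lie_conductor_def intro: pushforward_Lie_alg[OF aut])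
    finally show ?thesis .
  qed
  then show ?thesis using gR' by (simp add: lie_conductor_def)
qed

section \<open>Tangent spaces and differentials\<close>

lemma tangent_spaceD:
  assumes "v \<in> tangent_space X x"
  shows "f \<notin> coord_ring X \<Longrightarrow> v f = 0"
    and "f \<in> coord_ring X \<Longrightarrow> g \<in> coord_ring X \<Longrightarrow> v (\<lambda>y. f y + g y) = v f + v g"
    and "f \<in> coord_ring X \<Longrightarrow> v (\<lambda>y. c * f y) = c * v f"
    and "f \<in> coord_ring X \<Longrightarrow> g \<in> coord_ring X \<Longrightarrow> v (\<lambda>y. f y * g y) = f x * v g + g x * v f"
  using assms unfolding tangent_space_def by blast+

lemma tangent_space_subspace: "fun_space.subspace (tangent_space X x)"
  unfolding fun_space.subspace_def tangent_space_def by (simp add: algebra_simps)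

lemma derivation_at_tangent:
  assumes "is_derivation X D" shows "(\<lambda>f. D f x) \<in> tangent_space X x"
  using is_derivationD[OF assms] by (simp add: tangent_space_def)

lemma tangent_vector_eq_zero:
  assumes v: "v \<in> tangent_space X x" and x: "x \<in> X" and 0: "\<And>i. v (coord_fun X i) = 0"
  shows "v = 0"
proof
  fix f
  show "v f = 0 f"
  proof (cases "f \<in> coord_ring X")
    case True
    then show ?thesis
    proof (induction rule: coord_ring_induct)
      case (const c)
      let ?u = "restr X (\<lambda>x. 1)"
      have u: "?u \<in> coord_ring X" by (rule coord_ring_const)
      have "v (\<lambda>x. ?u x * ?u x) = v ?u" by (rule arg_cong[of _ _ v]) (auto simp: restr_def)
      then have "v ?u = 0" using x unfolding tangent_spaceD(4)[OF v u u] by (simp add: restr_def)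
      moreover have "restr X (\<lambda>x. c) = (\<lambda>x. c * ?u x)" by (auto simp: restr_def)
      ultimately show ?case using tangent_spaceD(3)[OF v u, of c] by simp
    qed (use tangent_spaceD[OF v] 0 in auto)
  qed (use tangent_spaceD(1)[OF v] in auto)
qed

lemma differential_tangent:
  assumes aut: "aut_pair X Y \<phi> \<psi>" and v: "v \<in> tangent_space X x" and x: "x \<in> X"
  shows "differential X \<phi> v \<in> tangent_space X (\<phi> x)"
proof -
  note vD = tangent_spaceD[OF v] and R = aut_pair_pullback[OF aut]
  have ev: "pullback X \<phi> f x = f (\<phi> x)" for f :: "'a rfun" using x by (simp add: pullback_def)
  show ?thesis
    unfolding tangent_space_def differential_def
  proof (intro CollectI conjI ballI)
    fix f g assume "f \<in> coord_ring X" "g \<in> coord_ring X"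
    then show "(if (\<lambda>y. f y * g y) \<in> coord_ring X then v (pullback X \<phi> (\<lambda>y. f y * g y)) else 0)
      = f (\<phi> x) * (if g \<in> coord_ring X then v (pullback X \<phi> g) else 0)
      + g (\<phi> x) * (if f \<in> coord_ring X then v (pullback X \<phi> f) else 0)"
      by (simp add: vD R ev coord_ring_intros pullback_mult)
  qed (simp_all add: vD R coord_ring_intros pullback_arith)
qed

lemma differential_inverse:
  assumes aut: "aut_pair X Y \<phi> \<psi>" and v: "v \<in> tangent_space X x"
  shows "differential X \<psi> (differential X \<phi> v) = v"
  using tangent_spaceD(1)[OF v] aut_pair_pullback[OF aut_pair_sym[OF aut]] pullback_pullback_inv[OF aut]
  by (intro ext) (auto simp: differential_def)

lemma fun_space_module: "module (\<lambda>(c::complex) (v::'a \<Rightarrow> complex) x. c * v x)"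
  by unfold_locales

lemma differential_hom:
  "module_hom (\<lambda>(c::complex) v x. c * v x) (\<lambda>(c::complex) v x. c * v x) (differential X \<phi>)"
  unfolding module_hom_iff by (auto simp: fun_space_module differential_def fun_eq_iff)

text \<open>A tangent vector is determined by its values on the coordinate functions, so
  \<open>c\<close> embeds the tangent space into a space of finite dimension and bounds a maximal
  independent set.\<close>

lemma tangent_space_finite_basis:
  assumes x: "x \<in> X"
  obtains B where "finite B" "B \<subseteq> tangent_space X x" "fun_space.independent B" "tangent_space X x \<subseteq> fun_space.span B"
proof -
  obtain B where B: "B \<subseteq> tangent_space X x" "fun_space.independent B" "tangent_space X x \<subseteq> fun_space.span B"
    by (rule fun_space.maximal_independent_subset)
  define c where "c v = (\<lambda>i. v (coord_fun X i))" for v :: "'a rfun \<Rightarrow> complex"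
  have hom: "module_hom (\<lambda>(c::complex) v x. c * v x) (\<lambda>(c::complex) v x. c * v x) c"
    unfolding module_hom_iff by (auto simp: fun_space_module c_def fun_eq_iff)
  have "fun_space.span B \<subseteq> tangent_space X x"
    using fun_space.span_minimal[OF B(1) tangent_space_subspace] .
  then have inj: "inj_on c (fun_space.span B)"
    unfolding module_hom.inj_on_iff_eq_0[OF hom fun_space.subspace_span]
    using tangent_vector_eq_zero[OF _ x] by (auto simp: c_def fun_eq_iff)
  then have ind: "fun_space.independent (c ` B)"
    using module_hom.independent_injective_image[OF hom B(2)] by blast
  define E :: "('a \<Rightarrow> complex) set" where "E = range (\<lambda>i j. if i = j then 1 else 0)"
  have "w \<in> fun_space.span E" for w
  proof -
    have "w = (\<Sum>i\<in>UNIV. (\<lambda>j. w i * (if i = j then 1 else 0)))"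
      by (auto simp: fun_eq_iff sum_fun_apply if_distrib cong: if_cong)
    also have "\<dots> \<in> fun_space.span E"
      unfolding E_def by (intro fun_space.span_sum fun_space.span_scale fun_space.span_base) auto
    finally show ?thesis .
  qed
  moreover have "finite E" by (simp add: E_def)
  ultimately have "finite (c ` B)"
    using fun_space.independent_span_bound[OF _ ind, of E] by blast
  then have "finite B"
    using finite_image_iff[OF inj_on_subset[OF inj fun_space.span_superset]] by blast
  then show ?thesis using B that by blast
qed

text \<open>Evaluation at \<open>f j\<close> reads off the coefficient of \<open>v j\<close>, up to
  the factor \<open>a\<close>. Injectivity is included because the family is later counted by its
  index set.\<close>

lemma dual_family:
  fixes v :: "'i \<Rightarrow> 'a \<Rightarrow> complex"
  assumes fin: "finite I" and a: "a \<noteq> 0"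
    and dual: "\<And>i j. i \<in> I \<Longrightarrow> j \<in> I \<Longrightarrow> v i (f j) = (if i = j then a else 0)"
  shows "inj_on v I" "fun_space.independent (v ` I)"
    "w \<in> fun_space.span (v ` I) \<Longrightarrow> (\<And>j. j \<in> I \<Longrightarrow> w (f j) = 0) \<Longrightarrow> w = 0"
proof -
  show inj: "inj_on v I"
    using dual a by (intro inj_onI) metis
  have eval: "(\<Sum>b\<in>v ` I. (\<lambda>x. u b * b x)) (f j) = u (v j) * a" if "j \<in> I" for u j
  proof -
    have "(\<Sum>b\<in>v ` I. (\<lambda>x. u b * b x)) (f j) = (\<Sum>i\<in>I. u (v i) * v i (f j))"
      by (simp add: sum_fun_apply sum.reindex[OF inj])
    also have "\<dots> = (\<Sum>i\<in>I. if i = j then u (v i) * a else 0)"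
      using dual that by (intro sum.cong) auto
    finally show ?thesis using fin that by simp
  qed
  show "fun_space.independent (v ` I)"
    unfolding fun_space.dependent_finite[OF finite_imageI[OF fin]]
  proof safe
    fix u i assume "(\<Sum>b\<in>v ` I. (\<lambda>x. u b * b x)) = 0" "i \<in> I" "u (v i) \<noteq> 0"
    then show False using eval[of i u] a by simp
  qed
  show "w = 0" if w: "w \<in> fun_space.span (v ` I)" "\<And>j. j \<in> I \<Longrightarrow> w (f j) = 0"
  proof -
    obtain u where u: "w = (\<Sum>b\<in>v ` I. (\<lambda>x. u b * b x))"
      using w(1) unfolding fun_space.span_finite[OF finite_imageI[OF fin]] by blast
    have "u b = 0" if "b \<in> v ` I" for b
      using that eval[of _ u] w(2) a unfolding u by auto
    then show ?thesis unfolding u by (intro sum.neutral) (auto simp: fun_eq_iff)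
  qed
qed

text \<open>The relation is imposed identically, not only at the base point, so one system can be
  used at every point where \<open>h\<close> is nonzero.\<close>

definition dual_system :: "(complex^'n::finite) set \<Rightarrow> (complex^'n) set \<Rightarrow> 'b set \<Rightarrow> 'n rfun \<Rightarrow>
    ('b \<Rightarrow> 'n rfun \<Rightarrow> 'n rfun) \<Rightarrow> ('b \<Rightarrow> 'n rfun) \<Rightarrow> bool" where
  "dual_system X Y B h F G \<longleftrightarrow> h \<in> coord_ring X \<and> (\<forall>b\<in>B. F b \<in> lie_core X Y \<and> G b \<in> coord_ring X
     \<and> (\<forall>c\<in>B. F b (G c) = (if b = c then h else (\<lambda>x. 0))))"

lemma dual_systemD:
  assumes "dual_system X Y B h F G"
  shows "h \<in> coord_ring X" "b \<in> B \<Longrightarrow> F b \<in> lie_core X Y" "b \<in> B \<Longrightarrow> G b \<in> coord_ring X"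
    "b \<in> B \<Longrightarrow> c \<in> B \<Longrightarrow> F b (G c) = (if b = c then h else (\<lambda>x. 0))"
  using assms unfolding dual_system_def by blast+

text \<open>Elimination without division, one vector at a time. The clause on spans keeps the values
  at \<open>x\<close> of the fields already built inside the old span, so the next vector stays
  independent of them.\<close>

lemma exists_dual_system:
  assumes "finite B" "fun_space.independent B"
    and "\<And>b. b \<in> B \<Longrightarrow> \<exists>D\<in>lie_core X Y. b = (\<lambda>f. D f x)" and x: "x \<in> X"
  shows "\<exists>h F G. dual_system X Y B h F G \<and> h x \<noteq> 0 \<and> (\<forall>b\<in>B. (\<lambda>f. F b f x) \<in> fun_space.span B)"
  using assms(1-3)
proof (induction B rule: finite_induct)
  case empty
  show ?case using coord_ring_const[of X 1] x
    by (intro exI[of _ "restr X (\<lambda>x. 1)"]) (auto simp: restr_def dual_system_def)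
next
  case (insert b B)
  have ind: "fun_space.independent B" "b \<notin> fun_space.span B"
    using insert.prems(1) insert.hyps(2) by (auto simp: fun_space.independent_insert)
  from insert.IH[OF ind(1) insert.prems(2)[OF insertI2]] obtain h F G
    where sys: "dual_system X Y B h F G" and hx: "h x \<noteq> 0"
      and Fx: "\<And>b. b \<in> B \<Longrightarrow> (\<lambda>f. F b f x) \<in> fun_space.span B"
    by blast
  note h = dual_systemD(1)[OF sys] hx and F = dual_systemD(2)[OF sys] and G = dual_systemD(3)[OF sys]
    and FG = dual_systemD(4)[OF sys]
  obtain D where D: "D \<in> lie_core X Y" "b = (\<lambda>f. D f x)" using insert.prems(2) by blast
  note DR = is_derivationD(1)[OF VF_alg_derivation[OF lie_core_VF_alg]]
  \<comment> \<open>The coefficients are chosen so that \<open>h D + S\<close> annihilates all old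
    \<open>G c\<close>.\<close>
  define S where "S = (\<lambda>f y. \<Sum>c\<in>B. - D (G c) y * F c f y)"
  define D' where "D' = vf_add (mod_smult h D) S"
  have "S \<in> lie_core X Y" unfolding S_def
    using insert.hyps(1) F DR[OF D(1) G] by (intro lie_core_sum coord_ring_uminus) auto
  then have D': "D' \<in> lie_core X Y"
    unfolding D'_def using D h by (intro lie_core_add lie_core_smult)
  have D'G: "D' (G c) = (\<lambda>x. 0)" if "c \<in> B" for c
  proof
    fix y
    have "S (G c) y = (\<Sum>e\<in>B. if e = c then - D (G e) y * h y else 0)"
      unfolding S_def using FG that by (intro sum.cong) auto
    also have "\<dots> = - D (G c) y * h y" using that insert.hyps(1) by simp
    finally show "D' (G c) y = 0" by (simp add: D'_def vf_add_def mod_smult_def)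
  qed
  have Sx: "(\<lambda>f. S f x) \<in> fun_space.span B"
  proof -
    have "(\<lambda>f. S f x) = (\<Sum>c\<in>B. (\<lambda>f. - D (G c) x * F c f x))"
      by (simp add: S_def fun_eq_iff sum_fun_apply)
    also have "\<dots> \<in> fun_space.span B"
      by (intro fun_space.span_sum fun_space.span_scale Fx)
    finally show ?thesis .
  qed
  have D'x: "(\<lambda>f. D' f x) = (\<lambda>f. h x * b f) + (\<lambda>f. S f x)"
    by (auto simp: D'_def vf_add_def mod_smult_def D(2))
  \<comment> \<open>A vanishing value would make \<open>b\<close> a combination of the old vectors,
    because \<open>h x\<close> is invertible. Hence some \<open>f\<close> can serve as
    pivot.\<close>
  have "(\<lambda>f. D' f x) \<noteq> 0"
  proof
    assume "(\<lambda>f. D' f x) = 0"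
    then have "h x * b f + S f x = 0" for f using D'x by (simp add: fun_eq_iff)
    then have "b = (\<lambda>f. (- 1 / h x) * S f x)"
      using h(2) by (auto simp: fun_eq_iff field_simps add_eq_0_iff)
    then show False using fun_space.span_scale[OF Sx, of "- 1 / h x"] ind(2) by simp
  qed
  then obtain f where f: "D' f x \<noteq> 0" by (auto simp: fun_eq_iff)
  then have fR: "f \<in> coord_ring X"
    using is_derivationD(2)[OF VF_alg_derivation[OF lie_core_VF_alg[OF D']]] by metis
  have h': "D' f \<in> coord_ring X" using DR[OF D' fR] .
  \<comment> \<open>Cross-multiplication clears the new column: \<open>D' f\<close> times
    \<open>F c\<close> minus \<open>F c f\<close> times \<open>D'\<close> annihilates
    \<open>f\<close>. Since \<open>D'\<close> annihilates the old \<open>G c\<close>, old and new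
    fields share the diagonal entry \<open>h * D' f\<close>.\<close>
  define F' where "F' c = (if c = b then mod_smult h D'
      else vf_add (mod_smult (D' f) (F c)) (mod_smult (\<lambda>x. - F c f x) D'))" for c
  define G' where "G' = G(b := f)"
  define h'' where "h'' = (\<lambda>x. h x * D' f x)"
  have "h'' \<in> coord_ring X" "h'' x \<noteq> 0" using h h' f by (auto simp: h''_def intro: coord_ring_mult)
  moreover have "F' c \<in> lie_core X Y" if "c \<in> insert b B" for c
    unfolding F'_def using that D' F h h' fR DR[OF F fR]
    by (auto intro!: lie_core_add lie_core_smult coord_ring_uminus)
  moreover have "G' c \<in> coord_ring X" if "c \<in> insert b B" for c
    using that G fR by (auto simp: G'_def)
  moreover have "(\<lambda>f. F' c f x) \<in> fun_space.span (insert b B)" if c: "c \<in> insert b B" for c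
  proof -
    have sub: "v \<in> fun_space.span (insert b B)" if "v \<in> fun_space.span B" for v
      using that fun_space.span_mono[of B "insert b B"] by blast
    have D'sp: "(\<lambda>f. D' f x) \<in> fun_space.span (insert b B)"
      unfolding D'x by (intro fun_space.span_add[OF fun_space.span_scale[OF fun_space.span_base] sub[OF Sx]]) simp
    show ?thesis
    proof (cases "c = b")
      case True
      then show ?thesis using fun_space.span_scale[OF D'sp, of "h x"] by (simp add: F'_def mod_smult_def)
    next
      case False
      then have "(\<lambda>g. F' c g x) = (\<lambda>g. D' f x * F c g x) + (\<lambda>g. - F c f x * D' g x)"
        by (auto simp: F'_def vf_add_def mod_smult_def)
      moreover have "c \<in> B" using c False by simp
      ultimately show ?thesis
        by (simp only:) (intro fun_space.span_add[OF fun_space.span_scale[OF sub[OF Fx]] fun_space.span_scale[OF D'sp]])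
    qed
  qed
  moreover have "F' c (G' e) = (if c = e then h'' else (\<lambda>x. 0))" if "c \<in> insert b B" "e \<in> insert b B" for c e
    using that FG D'G insert.hyps(2)
    by (auto simp: F'_def G'_def h''_def vf_add_def mod_smult_def fun_eq_iff algebra_simps)
  ultimately show ?case
    by (intro exI[of _ h''] exI[of _ F'] exI[of _ G']) (simp add: dual_system_def)
qed

lemma dual_system_conductor:
  fixes X Y :: "(complex^'n::finite) set"
  assumes "Y \<subseteq> X" and hom: "homogeneous_rel X Y" and x: "x \<in> X - Y"
    and fin: "finite B" and B: "tangent_space X x \<subseteq> fun_space.span B"
    and sys: "dual_system X Y B h F G"
  shows "(\<lambda>x. h x * h x) \<in> lie_conductor X Y"
proof -
  note h = dual_systemD(1)[OF sys] and F = dual_systemD(2)[OF sys] and G = dual_systemD(3)[OF sys]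
    and FG = dual_systemD(4)[OF sys]
  have "mod_smult (\<lambda>x. h x * h x) D \<in> Lie_alg X Y" if D: "D \<in> VF_alg X Y" for D
  proof -
    note D_der = VF_alg_derivation[OF D]
    have key: "h y * D f y = (\<Sum>b\<in>B. D (G b) y * F b f y)" if hy: "h y \<noteq> 0" for f y
    proof (cases "y \<in> Y")
      case True
      then show ?thesis using VF_alg_vanish[OF D] VF_alg_vanish[OF lie_core_VF_alg[OF F]] by simp
    next
      case False
      have yX: "y \<in> X" using hy coord_ring_outside[OF h] by blast
      then obtain \<phi> where \<phi>: "\<phi> \<in> Aut_rel X Y" "\<phi> x = y" using hom x False by (auto simp: homogeneous_rel_def)
      then obtain \<psi> where aut: "aut_pair X Y \<phi> \<psi>" using Aut_rel_aut_pair \<open>Y \<subseteq> X\<close> by blast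
      \<comment> \<open>Transport along \<open>\<phi>\<close> bounds the dimension at
        \<open>y\<close> by the size of \<open>B\<close>.\<close>
      have Ty: "tangent_space X y \<subseteq> fun_space.span (differential X \<phi> ` B)"
      proof
        fix v assume v: "v \<in> tangent_space X y"
        have "\<psi> y = x" using aut_pair_inv[OF aut, of x] \<phi>(2) x by simp
        then have "differential X \<psi> v \<in> fun_space.span B"
          using differential_tangent[OF aut_pair_sym[OF aut] v yX] B by auto
        moreover have "differential X \<phi> (differential X \<psi> v) = v"
          using differential_inverse[OF aut_pair_sym[OF aut] v] .
        ultimately show "v \<in> fun_space.span (differential X \<phi> ` B)"
          unfolding module_hom.span_image[OF differential_hom] by (metis imageI)
      qed
      let ?v = "\<lambda>b f. F b f y"
      have dual: "?v b (G c) = (if b = c then h y else 0)" if "b \<in> B" "c \<in> B" for b c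
        using FG[OF that] by simp
      note dual_facts = dual_family[where v = ?v and f = G and I = B, OF fin hy dual]
      \<comment> \<open>The error in the expansion of \<open>h D\<close>; it is a tangent vector
        that annihilates every \<open>G c\<close>.\<close>
      define w where "w = (\<lambda>f. h y * D f y) - (\<Sum>b\<in>B. (\<lambda>f. D (G b) y * F b f y))"
      have vT: "?v ` B \<subseteq> tangent_space X y"
        using F derivation_at_tangent[OF VF_alg_derivation[OF lie_core_VF_alg]] by blast
      have wT: "w \<in> tangent_space X y"
        unfolding w_def using vT derivation_at_tangent[OF D_der, of y]
        by (intro fun_space.subspace_diff[OF tangent_space_subspace] fun_space.subspace_sum[OF tangent_space_subspace]
            fun_space.subspace_scale[OF tangent_space_subspace]) auto
      have "w \<in> fun_space.span (?v ` B)"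
      \<comment> \<open>Otherwise \<open>w\<close> and the values of the \<open>F b\<close> would
        form an independent set with one element more than \<open>B\<close>, inside a space spanned
        by at most as many vectors as \<open>B\<close> has.\<close>
      proof (rule ccontr)
        assume w: "w \<notin> fun_space.span (?v ` B)"
        then have "w \<notin> ?v ` B" using fun_space.span_base[of w "?v ` B"] by metis
        then have "card (insert w (?v ` B)) = Suc (card B)"
          using fin card_image[OF dual_facts(1)] by simp
        moreover have "insert w (?v ` B) \<subseteq> fun_space.span (differential X \<phi> ` B)"
          using wT vT Ty by (simp only: insert_subset) (meson subsetD subset_trans)
        then have "card (insert w (?v ` B)) \<le> card (differential X \<phi> ` B)"
          using fun_space.independent_span_bound[OF finite_imageI[OF fin]
              fun_space.independent_insertI[OF w dual_facts(2)]] by metis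
        moreover have "card (differential X \<phi> ` B) \<le> card B" using fin by (rule card_image_le)
        ultimately show False by simp
      qed
      moreover have "w (G c) = 0" if "c \<in> B" for c
      proof -
        have "(\<Sum>b\<in>B. D (G b) y * F b (G c) y) = (\<Sum>b\<in>B. if b = c then D (G b) y * h y else 0)"
          using dual that by (intro sum.cong) auto
        then show ?thesis using that fin by (simp add: w_def sum_fun_apply)
      qed
      ultimately have "w = 0" using dual_facts(3) by blast
      then have "w f = 0" by simp
      then show ?thesis by (simp add: w_def sum_fun_apply)
    qed
    \<comment> \<open>The extra factor covers the zeros of \<open>h\<close>, where both sides
      vanish.\<close>
    have "h y * h y * D f y = (\<Sum>b\<in>B. (h y * D (G b) y) * F b f y)" for f y
      using key[of y f] by (cases "h y = 0") (simp_all add: sum_distrib_left[symmetric] mult.assoc)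
    then have "mod_smult (\<lambda>x. h x * h x) D = (\<lambda>f y. \<Sum>b\<in>B. (\<lambda>y. h y * D (G b) y) y * F b f y)"
      by (intro ext) (simp add: mod_smult_def)
    also have "\<dots> \<in> lie_core X Y"
      using F G h is_derivationD(1)[OF D_der] by (intro lie_core_sum[OF fin] coord_ring_mult) auto
    finally show ?thesis using lie_core_subset_Lie_alg by blast
  qed
  then show ?thesis using h by (auto simp: lie_conductor_def intro: coord_ring_mult)
qed

text \<open>For \<open>\<phi>\<close> fixing \<open>x\<close>, the differential takes the value of
  \<open>D\<close> at \<open>x\<close> to the value there of the pushforward of \<open>D\<close>,
  which stays in \<open>lie_core\<close>. The scalars of the combination become constant functions
  on \<open>X\<close>.\<close>

lemma fiber_lie_core:
  assumes "Y \<subseteq> X" and x: "x \<in> X" and L: "L \<subseteq> lie_core X Y"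
    and S: "S \<subseteq> fiber X L x" "generating_set X Y x S" and v: "v \<in> tangent_space X x"
  shows "\<exists>D\<in>lie_core X Y. v = (\<lambda>f. D f x)"
proof -
  have "v \<in> cspan {differential X \<phi> v | \<phi> v. \<phi> \<in> Aut_rel X Y \<and> \<phi> x = x \<and> v \<in> S}"
    using S(2) v by (simp add: generating_set_def)
  then obtain T c where T: "finite T" "T \<subseteq> {differential X \<phi> v | \<phi> v. \<phi> \<in> Aut_rel X Y \<and> \<phi> x = x \<and> v \<in> S}"
    "v = (\<lambda>f. \<Sum>u\<in>T. c u * u f)" unfolding cspan_def by blast
  have "\<exists>D\<in>lie_core X Y. u = (\<lambda>f. D f x)" if uT: "u \<in> T" for u
  proof -
    obtain \<phi> s where u: "u = differential X \<phi> s" "\<phi> \<in> Aut_rel X Y" "\<phi> x = x" "s \<in> S" using T(2) uT by blast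
    obtain \<psi> where aut: "aut_pair X Y \<phi> \<psi>" using Aut_rel_aut_pair u(2) assms(1) by blast
    obtain D where D: "D \<in> L" "s = (\<lambda>f. if f \<in> coord_ring X then D f x else 0)"
      using u(4) S(1) by (auto simp: fiber_def)
    have "\<psi> x = x" using aut_pair_inv[OF aut x] u(3) by simp
    then have "u = (\<lambda>f. pushforward X \<phi> \<psi> D f x)"
      using aut_pair_pullback[OF aut] x
      by (auto simp: u(1) D(2) differential_def pushforward_def fun_eq_iff) (simp add: pullback_def)
    then show ?thesis using pushforward_lie_core[OF aut] D(1) L by blast
  qed
  then obtain E where E: "\<And>u. u \<in> T \<Longrightarrow> E u \<in> lie_core X Y" "\<And>u. u \<in> T \<Longrightarrow> u = (\<lambda>f. E u f x)" by metis
  have "(\<lambda>f y. \<Sum>u\<in>T. restr X (\<lambda>_. c u) y * E u f y) \<in> lie_core X Y"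
    using E coord_ring_const by (intro lie_core_sum[OF T(1)])
  moreover have "v = (\<lambda>f. \<Sum>u\<in>T. restr X (\<lambda>_. c u) x * E u f x)"
    unfolding T(3) using E(2) x by (intro ext sum.cong) (auto simp: restr_def dest: fun_cong)
  ultimately show ?thesis
    by (intro bexI[of _ "\<lambda>f y. \<Sum>u\<in>T. restr X (\<lambda>_. c u) y * E u f y"])
qed

lemma lie_conductor_nonvanishing:
  fixes X Y :: "(complex^'n::finite) set"
  assumes "Y \<subseteq> X" "homogeneous_rel X Y" "fg_module X L" "L \<subseteq> VF_alg X Y" "L \<subseteq> Lie_alg X Y"
    and x0: "x0 \<in> X - Y" and S: "S \<subseteq> fiber X L x0" "generating_set X Y x0 S" and x: "x \<in> X - Y"
  shows "\<exists>g\<in>lie_conductor X Y. g x \<noteq> 0"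
proof -
  have x0X: "x0 \<in> X" using x0 by simp
  obtain B where B: "finite B" "B \<subseteq> tangent_space X x0" "fun_space.independent B"
    "tangent_space X x0 \<subseteq> fun_space.span B"
    using tangent_space_finite_basis[OF x0X] by blast
  have "\<exists>D\<in>lie_core X Y. b = (\<lambda>f. D f x0)" if "b \<in> B" for b
    using fiber_lie_core[OF assms(1) x0X fg_module_subset_lie_core[OF assms(3-5)] S] that B(2) by blast
  from exists_dual_system[OF B(1,3) this x0X] obtain h F G
    where sys: "dual_system X Y B h F G" and h: "h x0 \<noteq> 0" by blast
  have g: "(\<lambda>x. h x * h x) \<in> lie_conductor X Y"
    by (rule dual_system_conductor[OF assms(1,2) x0 B(1,4) sys])
  obtain \<phi> where \<phi>: "\<phi> \<in> Aut_rel X Y" "\<phi> x0 = x" using assms(2) x x0 unfolding homogeneous_rel_def by blast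
  then obtain \<psi> where aut: "aut_pair X Y \<phi> \<psi>" using Aut_rel_aut_pair assms(1) by blast
  have "\<psi> x = x0" using aut_pair_inv[OF aut x0X] \<phi>(2) by simp
  then have "pullback X \<psi> (\<lambda>x. h x * h x) x \<noteq> 0" using h x by (simp add: pullback_def)
  then show ?thesis using pullback_lie_conductor[OF aut g] by blast
qed

section \<open>From the conductor to a power of the ideal of \<open>Y\<close>\<close>

lemma lie_conductor_polys_ideal: "ideal_of poly_fun {p \<in> poly_fun. restr X p \<in> lie_conductor X Y}"
  unfolding ideal_of_def
proof (intro conjI ballI)
  let ?J = "{p \<in> poly_fun. restr X p \<in> lie_conductor X Y}"
  show "?J \<subseteq> poly_fun" by blast
  have "restr X 0 = (\<lambda>x. 0)" by (auto simp: restr_def)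
  then show "0 \<in> ?J"
    using Lie_alg.lzero subring_of_simps(2)[OF poly_fun_subring]
    by (auto simp: lie_conductor_def coord_ring_zero mod_smult_def)
  fix p assume p: "p \<in> ?J"
  show "p + q \<in> ?J" if q: "q \<in> ?J" for q
  proof -
    have "restr X (p + q) = (\<lambda>x. restr X p x + restr X q x)" by (auto simp: restr_def)
    then show ?thesis using p q subring_of_simps(3)[OF poly_fun_subring]
      by (auto simp: lie_conductor_def mod_smult_simps intro: coord_ring_add Lie_alg.ladd)
  qed
  show "r * p \<in> ?J" if r: "r \<in> poly_fun" for r
  proof -
    have "restr X (r * p) = (\<lambda>x. restr X p x * restr X r x)" by (auto simp: restr_def)
    moreover have "restr X r \<in> coord_ring X" using r by (auto simp: coord_ring_eq_restr)
    ultimately show ?thesis using p r subring_of_simps(4)[OF poly_fun_subring]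
      by (auto simp: lie_conductor_def simp flip: mod_smult_simps(2) intro: coord_ring_mult VF_alg_smult)
  qed
qed

lemma prod_list_fun_apply: "prod_list ps x = prod_list (map (\<lambda>p. p x) ps)"
  for ps :: "('a \<Rightarrow> 'b::comm_monoid_mult) list"
  by (induction ps) auto

lemma ideal_pow_subset_lie_conductor:
  fixes X Y :: "(complex^'n::finite) set"
  assumes X: "algebraic_set X" and YX: "Y \<subseteq> X"
    and nv: "\<And>x. x \<in> X - Y \<Longrightarrow> \<exists>g\<in>lie_conductor X Y. g x \<noteq> 0"
  shows "\<exists>N. ideal_pow X Y N \<subseteq> lie_conductor X Y"
proof -
  \<comment> \<open>Both ideals are lifted to the polynomial ring, where the Nullstellensatz and the
    basis theorem apply.\<close>
  define J where "J = {p \<in> poly_fun. restr X p \<in> lie_conductor X Y}"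
  define I where "I = {p \<in> poly_fun. \<forall>y\<in>Y. p y = (0::complex)}"
  have J: "ideal_of poly_fun J" unfolding J_def by (rule lie_conductor_polys_ideal)
  have I: "ideal_of poly_fun I"
    using subring_of_simps[OF poly_fun_subring] by (auto simp: ideal_of_def I_def)
  have zeros: "x \<in> Y" if x: "\<And>p. p \<in> J \<Longrightarrow> p x = 0" for x
  proof (rule ccontr)
    assume "x \<notin> Y"
    obtain S where S: "S \<subseteq> poly_fun" "X = {x. \<forall>p\<in>S. p x = 0}" using X by (auto simp: algebraic_set_def)
    \<comment> \<open>The equations of \<open>X\<close> restrict to zero and so belong to
      \<open>J\<close>; common zeros of \<open>J\<close> thus lie in \<open>X\<close>.\<close>
    have "p x = 0" if "p \<in> S" for p
    proof (rule x)
      have "restr X p = restr X 0" using S(2) that by (auto simp: restr_def)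
      then show "p \<in> J" using S(1) that ideal_of_simps(1)[OF J] by (auto simp: J_def)
    qed
    then have "x \<in> X" using S by blast
    then obtain g where g: "g \<in> lie_conductor X Y" "g x \<noteq> 0" using nv \<open>x \<notin> Y\<close> by blast
    then obtain p where "p \<in> poly_fun" "g = restr X p" by (auto simp: lie_conductor_def coord_ring_eq_restr)
    then show False using x[of p] g \<open>x \<in> X\<close> by (auto simp: J_def restr_def)
  qed
  have "\<exists>n. p ^ n \<in> J" if "p \<in> I" for p
    using nullstellensatz[OF J, of p] that zeros by (auto simp: I_def)
  then obtain N where N: "\<And>ps. length ps = N \<Longrightarrow> set ps \<subseteq> I \<Longrightarrow> prod_list ps \<in> J"
    using noetherian_imp_ideal_pow_subset[OF poly_fun_subring poly_fun_noetherian J I] by blast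
  have "g \<in> lie_conductor X Y" if "g \<in> ideal_pow X Y N" for g
    using that
  proof induction
    case (ipgen r fs)
    obtain q where q: "q \<in> poly_fun" "r = restr X q" using ipgen(1) by (auto simp: coord_ring_eq_restr)
    \<comment> \<open>Because \<open>Y \<subseteq> X\<close>, any polynomial lift of a function
      vanishing on \<open>Y\<close> vanishes there too.\<close>
    have "\<forall>f\<in>set fs. \<exists>p\<in>I. f = restr X p"
      using ipgen(3) YX by (force simp: vanishing_ideal_def coord_ring_eq_restr I_def restr_def)
    then obtain P where P: "\<And>f. f \<in> set fs \<Longrightarrow> P f \<in> I" "\<And>f. f \<in> set fs \<Longrightarrow> f = restr X (P f)" by metis
    have "prod_list (map P fs) \<in> J" using ipgen(2) P(1) by (intro N) auto
    then have "q * prod_list (map P fs) \<in> J" using q(1) ideal_of_simps(4)[OF J] by blast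
    moreover have "restr X (q * prod_list (map P fs)) = (\<lambda>x. r x * prod_list (map (\<lambda>f. f x) fs))"
    proof
      fix x
      have eq: "prod_list (map (\<lambda>f. P f x) fs) = prod_list (map (\<lambda>f. f x) fs)" if "x \<in> X"
        using fun_cong[OF P(2), of _ x] that by (intro arg_cong[of _ _ prod_list] map_cong) (auto simp: restr_def)
      show "restr X (q * prod_list (map P fs)) x = r x * prod_list (map (\<lambda>f. f x) fs)"
        by (cases "x \<in> X") (simp_all add: q(2) restr_def prod_list_fun_apply o_def eq)
    qed
    ultimately show ?case by (simp add: J_def)
  next
    case (ipadd f g)
    then show ?case by (auto simp: lie_conductor_def mod_smult_simps intro: coord_ring_add Lie_alg.ladd)
  qed
  then show ?thesis by blast
qed

theorem theorem2p2:
  fixes X Y :: "(complex^'n::finite) set"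
    and L :: "('n rfun \<Rightarrow> 'n rfun) set"
    and x0 :: "complex^'n"
  assumes "affine_variety X"
    and "algebraic_set Y" and "Y \<subseteq> X"
    and "sing_locus X \<subseteq> Y"
    and "homogeneous_rel X Y"
    and "fg_module X L" and "L \<subseteq> VF_alg X Y" and "L \<subseteq> Lie_alg X Y"
    and "x0 \<in> X - Y"
    and "\<exists>S. S \<subseteq> fiber X L x0 \<and> generating_set X Y x0 S"
  shows "ADP_rel X Y"
proof -
  obtain S where S: "S \<subseteq> fiber X L x0" "generating_set X Y x0 S" using assms(10) by blast
  obtain N where N: "ideal_pow X Y N \<subseteq> lie_conductor X Y"
    using ideal_pow_subset_lie_conductor[OF _ assms(3)]
      lie_conductor_nonvanishing[OF assms(3,5-9) S] assms(1)
    unfolding affine_variety_def by blast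
  have "D \<in> Lie_alg X Y" if "D \<in> module_prod (ideal_pow X Y N) (VF_alg X Y)" for D
    using that
  proof induction
    case (mpgen g D)
    then show ?case using N by (auto simp: lie_conductor_def)
  next
    case (mpadd D E)
    then show ?case using Lie_alg.ladd by blast
  qed
  then show ?thesis unfolding ADP_rel_def by blast
qed

end
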